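(* Let $\mathbf{P}\subset\mathbb{C}$ be a Jordan arc and let $A\colon\mathbf{P}\to\mathbb{C}^{n\times n}$, $B\colon\mathbf{P}\to\mathbb{C}^{n\times m}$ be continuous such that $(A(\theta),B(\theta))$ is reachable for every $\theta\in\mathbf{P}$ and the Kronecker indices $\kappa(A(\theta),B(\theta))$ are independent of $\theta\in\mathbf{P}$. Then there exists a restricted feedback transformation $(T,F,S)$ on $\mathbf{P}$ such that the pair $(\tilde A,\tilde B)=(T,F,S)\cdot(A,B)$ is uniformly ensemble reachable.
   Context: A Jordan arc is the image of a continuous injective map from a compact interval into $\mathbb{C}$. For a pair $(A,B)\in\mathbb{C}^{n\times n}\times\mathbb{C}^{n\times m}$ with columns $b_1,\dots,b_m$ of $B$, the Kronecker indices $\kappa(A,B)=(\kappa_1,\dots,\kappa_m)$ are defined as follows: go through the list $b_1,\dots,b_m,Ab_1,\dots,Ab_m,\dots,A^{n-1}b_1,\dots,A^{n-1}b_m$ from left to right and select each vector that is linearly independent of the previously selected ones; the selected vectors are then of the form $b_i,Ab_i,\dots,A^{\kappa_i-1}b_i$ ($i=1,\dots,m$), which defines $\kappa_i$ ($\kappa_i=0$ if $b_i$ is not selected). A restricted feedback transformation on $\mathbf{P}$ is a triple $(T,F,S)$ of continuous maps $T\colon\mathbf{P}\to\mathbb{C}^{n\times n}$, $F\colon\mathbf{P}\to\mathbb{C}^{m\times n}$, $S\colon\mathbf{P}\to\mathbb{C}^{m\times m}$ such that for every $\theta$, $T(\theta)$ is invertible and $S(\theta)$ is upper triangular with all diagonal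 entries equal to $1$. It acts by $(T,F,S)\cdot(A,B)=\big(T(A-BS^{-1}F)T^{-1},\,TBS^{-1}\big)$, pointwise in $\theta$. For continuous $A,B$ on $\mathbf{P}$, the pair $(A,B)$ is uniformly ensemble reachable (from zero) if for every continuous $f\colon\mathbf{P}\to\mathbb{C}^n$ and every $\varepsilon>0$ there exist $T>0$ and a $\theta$-independent input $u$ such that $\sup_{\theta\in\mathbf{P}}\|\varphi(T,0,u)(\theta)-f(\theta)\|<\varepsilon$, where in continuous time ($\partial_t x=A(\theta)x+B(\theta)u(t)$, $x(0,\theta)=0$, $u\in L^1([0,T],\mathbb{C}^m)$) $\varphi(T,0,u)(\theta)=\int_0^Te^{A(\theta)(T-s)}B(\theta)u(s)\,ds$, and in discrete time ($x_{t+1}=A(\theta)x_t+B(\theta)u_t$, $x_0=0$, $T\in\mathbb{N}$, $u_i\in\mathbb{C}^m$) $\varphi(T,0,u)(\theta)=\sum_{k=0}^{T-1}A(\theta)^kB(\theta)u_{T-1-k}$. The result holds for either notion. *)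

theory Defs
  imports "HOL-Analysis.Analysis"
begin

text \<open>Matrices are Cartesian matrices: an n x m complex matrix is complex^'m^'n
  (rows indexed by 'n, columns by 'm).  The column index type 'm carries a linear
  order, giving the column ordering b_1,...,b_m.\<close>

primrec mpow :: "complex^'n^'n \<Rightarrow> nat \<Rightarrow> complex^'n^'n" where
  "mpow A 0 = mat 1"
| "mpow A (Suc k) = A ** mpow A k"

definition mexp :: "complex^'n^'n \<Rightarrow> complex^'n^'n" where
  "mexp A = (\<chi> i j. (\<Sum>k. (mpow A k $ i $ j) / of_nat (fact k)))"

definition reachable :: "complex^'n^'n \<Rightarrow> complex^'m^'n \<Rightarrow> bool" where
  "reachable A B \<longleftrightarrow>
     vec.span {mpow A k *v column i B | k i. k < CARD('n)} = UNIV"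

text \<open>Kronecker indices: going through b_1..b_m, Ab_1..Ab_m, ..., A^(n-1)b_1..A^(n-1)b_m,
  the vector A^k b_i is selected iff it is linearly independent of the previously
  selected ones, equivalently not in the span of all vectors preceding it in the list.
  kappa_i is the number of selected vectors of the form A^k b_i.\<close>
definition kronecker_indices ::
  "complex^'n^'n \<Rightarrow> complex^'m::{finite,linorder}^'n \<Rightarrow> 'm \<Rightarrow> nat" where
  "kronecker_indices A B i = card {k. k < CARD('n) \<and>
      mpow A k *v column i B \<notin>
        vec.span {mpow A l *v column j B | l j. l < CARD('n) \<and> (l < k \<or> (l = k \<and> j < i))}}"

definition jordan_arc :: "complex set \<Rightarrow> bool" where
  "jordan_arc P \<longleftrightarrow> (\<exists>\<gamma>. arc \<gamma> \<and> path_image \<gamma> = P)"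

definition unit_upper_triangular :: "(('a::zero_neq_one, 'm::{finite,linorder}) vec, 'm) vec \<Rightarrow> bool" where
  "unit_upper_triangular S \<longleftrightarrow> (\<forall>i j. j < i \<longrightarrow> S $ i $ j = 0) \<and> (\<forall>i. S $ i $ i = 1)"

definition restricted_feedback ::
  "complex set \<Rightarrow> (complex \<Rightarrow> complex^'n^'n) \<Rightarrow> (complex \<Rightarrow> (complex^'n, 'm::{finite,linorder}) vec)
     \<Rightarrow> (complex \<Rightarrow> ((complex, 'm::{finite,linorder}) vec, 'm::{finite,linorder}) vec) \<Rightarrow> bool" where
  "restricted_feedback P T F S \<longleftrightarrow>
     continuous_on P T \<and> continuous_on P F \<and> continuous_on P S \<and>
     (\<forall>\<theta>\<in>P. invertible (T \<theta>) \<and> unit_upper_triangular (S \<theta>))"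

definition fb_A :: "(complex \<Rightarrow> complex^'n^'n) \<Rightarrow> (complex \<Rightarrow> complex^'n^'m)
     \<Rightarrow> (complex \<Rightarrow> complex^'m^'m) \<Rightarrow> (complex \<Rightarrow> complex^'n^'n) \<Rightarrow> (complex \<Rightarrow> complex^'m^'n)
     \<Rightarrow> complex \<Rightarrow> complex^'n^'n" where
  "fb_A T F S A B \<theta> =
     T \<theta> ** (A \<theta> - B \<theta> ** matrix_inv (S \<theta>) ** F \<theta>) ** matrix_inv (T \<theta>)"

definition fb_B :: "(complex \<Rightarrow> complex^'n^'n) \<Rightarrow> (complex \<Rightarrow> complex^'n^'m)
     \<Rightarrow> (complex \<Rightarrow> complex^'m^'m) \<Rightarrow> (complex \<Rightarrow> complex^'n^'n) \<Rightarrow> (complex \<Rightarrow> complex^'m^'n)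
     \<Rightarrow> complex \<Rightarrow> complex^'m^'n" where
  "fb_B T F S A B \<theta> = T \<theta> ** B \<theta> ** matrix_inv (S \<theta>)"

definition uer_ct :: "complex set \<Rightarrow> (complex \<Rightarrow> complex^'n^'n) \<Rightarrow> (complex \<Rightarrow> complex^'m^'n) \<Rightarrow> bool" where
  "uer_ct P A B \<longleftrightarrow>
    (\<forall>f. continuous_on P f \<longrightarrow> (\<forall>\<epsilon>>0. \<exists>T::real. T > 0 \<and>
       (\<exists>u :: real \<Rightarrow> complex^'m. u absolutely_integrable_on {0..T} \<and>
          (SUP \<theta>\<in>P. norm (integral {0..T} (\<lambda>s. mexp ((T - s) *\<^sub>R A \<theta>) *v (B \<theta> *v u s)) - f \<theta>)) < \<epsilon>)))"

definition uer_dt :: "complex set \<Rightarrow> (complex \<Rightarrow> complex^'n^'n) \<Rightarrow> (complex \<Rightarrow> complex^'m^'n) \<Rightarrow> bool" where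
  "uer_dt P A B \<longleftrightarrow>
    (\<forall>f. continuous_on P f \<longrightarrow> (\<forall>\<epsilon>>0. \<exists>T::nat. \<exists>u :: nat \<Rightarrow> complex^'m.
          (SUP \<theta>\<in>P. norm ((\<Sum>k<T. mpow (A \<theta>) k *v (B \<theta> *v u (T - 1 - k))) - f \<theta>)) < \<epsilon>))"

end

theory Submission
  imports Defs
begin

text \<open>
  Write \<open>\<kappa>\<close> for the constant Kronecker indices. Expressing \<open>A^\<kappa>\<^sub>i b\<^sub>i\<close> in the basis of selected
  vectors gives a relation with continuous coefficients that involves only preceding vectors, hence
  vectors \<open>w\<^sub>i\<^sub>0 = B c\<^sub>i\<^sub>0\<close>, \<open>w\<^sub>i\<^sub>,\<^sub>l\<^sub>+\<^sub>1 = A w\<^sub>i\<^sub>l + B c\<^sub>i\<^sub>,\<^sub>l\<^sub>+\<^sub>1\<close> with \<open>w\<^sub>i\<^sub>l = 0\<close> for \<open>l = \<kappa>\<^sub>i\<close>.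
  The vectors \<open>c\<^sub>i\<^sub>0\<close> are the columns of a unit upper triangular matrix, which is taken as \<open>S\<inverse>\<close>, and the
  \<open>w\<^sub>i\<^sub>l\<close> with \<open>l < \<kappa>\<^sub>i\<close> are a unitriangular modification of the selected vectors, hence a basis. Since
  each step of a chain changes only by elements of the image of \<open>B\<close>, a feedback \<open>F\<close> (with \<open>T = 1\<close>) makes the
  new matrix act by \<open>w\<^sub>i\<^sub>l \<mapsto> w\<^sub>i\<^sub>,\<^sub>l\<^sub>+\<^sub>1\<close> and sends the last vector of each chain to \<open>g(\<theta>) w\<^sub>i\<^sub>0\<close>, where
  \<open>g\<close> is the inverse of the parametrisation of the arc. The Krylov vectors of the new pair are then
  exactly the \<open>g(\<theta>)^q w\<^sub>i\<^sub>l\<close>, and these span a uniformly dense subspace by the Weierstrass theorem.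

  In discrete time the Krylov vectors are reachable. In continuous time they are uniform limits of
  reachable functions: if \<open>M\<^sub>\<tau> = \<integral>\<^sub>0\<^sup>\<tau> exp(s A) b ds\<close>, then
  \<open>(N+1)!/\<tau>^(N+1) (M\<^sub>\<tau> - \<Sum>\<^sub>k\<^sub><\<^sub>N \<tau>^(k+1)/(k+1)! A^k b)\<close> tends to \<open>A^N b\<close> as \<open>\<tau>\<close> tends to 0, so induction
  on \<open>N\<close> applies.
\<close>

section \<open>Linear algebra with continuous matrices\<close>

lemma mpow_add: "mpow A (j + k) = mpow A j ** mpow A k"
  by (induction j) (simp_all add: matrix_mul_assoc)

lemma mpow_Suc_mult_vec: "mpow A (Suc k) *v x = A *v (mpow A k *v x)"
  by (simp add: matrix_vector_mul_assoc)

lemma matrix_vector_mult_axis: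
  fixes M :: "complex^'m^'n"
  shows "M *v axis j 1 = column j M"
  by (simp add: matrix_vector_mul_component vec_eq_iff matrix_vector_mult_def axis_def column_def if_distrib
      cong: if_cong)

lemma norm_matrix_vector_mult_le:
  fixes M :: "complex^'m^'n"
  shows "norm (M *v x) \<le> (\<Sum>i\<in>UNIV. \<Sum>j\<in>UNIV. norm (M $ i $ j)) * norm x"
proof -
  have "norm ((M *v x) $ i) \<le> (\<Sum>j\<in>UNIV. norm (M $ i $ j)) * norm x" for i
    unfolding matrix_vector_mult_def sum_distrib_right
    by (simp, intro sum_norm_le) (simp add: norm_mult mult_left_mono Finite_Cartesian_Product.norm_nth_le)
  then have "(\<Sum>i\<in>UNIV. norm ((M *v x) $ i)) \<le> (\<Sum>i\<in>UNIV. (\<Sum>j\<in>UNIV. norm (M $ i $ j)) * norm x)"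
    by (intro sum_mono)
  then show ?thesis
    unfolding sum_distrib_right[symmetric] norm_vec_def[of "M *v x"]
    by (rule order_trans[OF L2_set_le_sum, rotated]) simp
qed

lemma norm_scaleC_vec:
  fixes x :: "complex^'n"
  shows "norm (c *s x) = norm c * norm x"
  by (simp add: norm_vec_def norm_mult L2_set_right_distrib)

lemma scaleR_eq_of_real_smult:
  fixes x :: "complex^'n"
  shows "r *\<^sub>R x = complex_of_real r *s x"
  by (simp add: vec_eq_iff scaleR_conv_of_real[where 'a=complex])

lemma continuous_on_matrix_vector_mult:
  fixes M :: "'a::topological_space \<Rightarrow> complex^'m^'n"
  assumes "continuous_on P M" "continuous_on P x"
  shows "continuous_on P (\<lambda>t. M t *v x t)"
  unfolding matrix_vector_mult_def using assms
  by (auto intro!: continuous_intros)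

lemma continuous_on_matrix_mult:
  fixes M :: "'a::topological_space \<Rightarrow> complex^'m^'n" and N :: "'a \<Rightarrow> complex^'k^'m"
  assumes "continuous_on P M" "continuous_on P N"
  shows "continuous_on P (\<lambda>t. M t ** N t)"
  unfolding matrix_matrix_mult_def using assms
  by (auto intro!: continuous_intros)

lemma continuous_on_mpow:
  assumes "continuous_on P M"
  shows "continuous_on P (\<lambda>t. mpow (M t) k)"
  by (induction k) (auto intro!: continuous_on_matrix_mult assms)

lemma continuous_on_column:
  fixes M :: "'a::topological_space \<Rightarrow> complex^'m^'n"
  assumes "continuous_on P M"
  shows "continuous_on P (\<lambda>t. column j (M t))"
  unfolding column_def using assms by (auto intro!: continuous_intros)

lemma continuous_on_smult:
  fixes x :: "'a::topological_space \<Rightarrow> complex^'n"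
  assumes "continuous_on P c" "continuous_on P x"
  shows "continuous_on P (\<lambda>t. c t *s x t)"
  unfolding vector_scalar_mult_def using assms by (auto intro!: continuous_intros)

lemma continuous_on_det:
  fixes M :: "'a::topological_space \<Rightarrow> complex^'n^'n"
  assumes "continuous_on P M"
  shows "continuous_on P (\<lambda>t. det (M t))"
  unfolding det_def using assms by (auto intro!: continuous_intros)

lemma matrix_inv_mult:
  fixes M :: "complex^'n^'n"
  assumes "invertible M"
  shows "M ** matrix_inv M = mat 1" "matrix_inv M ** M = mat 1"
  using assms someI_ex[of "\<lambda>N. M ** N = mat 1 \<and> N ** M = mat 1"]
  unfolding invertible_def matrix_inv_def by auto

lemma matrix_inv_eqI:
  fixes M :: "complex^'n^'n"
  assumes "M ** N = mat 1"
  shows "matrix_inv M = N"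
proof -
  have "N ** M = mat 1" using assms by (simp add: matrix_left_right_inverse)
  then have "invertible M" using assms by (auto simp: invertible_def)
  then show ?thesis
    by (metis assms matrix_inv_mult(2) matrix_mul_assoc matrix_mul_lid matrix_mul_rid)
qed

text \<open>By Cramer's rule the entries of the inverse are quotients of determinants, which depend
  continuously on the entries, with nonvanishing denominator \<open>det (M t)\<close>.\<close>

lemma continuous_on_matrix_inv:
  fixes M :: "'a::topological_space \<Rightarrow> complex^'n^'n"
  assumes "continuous_on P M" "\<And>t. t \<in> P \<Longrightarrow> invertible (M t)"
  shows "continuous_on P (\<lambda>t. matrix_inv (M t))"
proof -
  have nz: "det (M t) \<noteq> 0" if "t \<in> P" for t
    using assms(2)[OF that] by (simp add: invertible_det_nz)
  have "continuous_on P (\<lambda>t. \<chi> k l. det (\<chi> i j. if j = k then (axis l 1 :: complex^'n) $ i else M t $ i $ j) / det (M t))"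
  proof (intro continuous_on_vec_lambda continuous_on_divide continuous_on_det)
    fix k l i j
    show "continuous_on P (\<lambda>t. if j = k then (axis l 1 :: complex^'n) $ i else M t $ i $ j)"
      using assms by (cases "j = k") (auto intro!: continuous_intros)
  qed (use assms nz in auto)
  moreover have "matrix_inv (M t) = (\<chi> k l. det (\<chi> i j. if j = k then (axis l 1 :: complex^'n) $ i else M t $ i $ j) / det (M t))"
    if "t \<in> P" for t
  proof -
    have "M t *v column l (matrix_inv (M t)) = axis l 1" for l
      by (metis assms(2) that matrix_inv_mult(1) matrix_vector_mul_assoc matrix_vector_mul_lid matrix_vector_mult_axis)
    then have "column l (matrix_inv (M t)) = (\<chi> k. det (\<chi> i j. if j = k then (axis l 1 :: complex^'n) $ i else M t $ i $ j) / det (M t))" for l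
      by (simp only: cramer[OF nz[OF that]])
    then show ?thesis
      by (simp add: column_def vec_eq_iff)
  qed
  ultimately show ?thesis by (simp cong: continuous_on_cong)
qed

lemma invertible_iff_span_columns:
  fixes M :: "complex^'n^'n"
  shows "invertible M \<longleftrightarrow> vec.span (columns M) = UNIV"
  by (metis invertible_def matrix_left_right_inverse matrix_right_invertible_span_columns)

text \<open>Vectors are inserted in order of increasing rank; injectivity of \<open>r\<close> makes
  the inserted element strictly the largest, so the hypothesis places its vector outside the span of
  all earlier ones.\<close>

lemma independent_rankI:
  fixes v :: "'x \<Rightarrow> complex^'n" and r :: "'x \<Rightarrow> nat"
  assumes "finite K" "inj_on r K" 
    and "\<And>x. x \<in> K \<Longrightarrow> v x \<notin> vec.span (v ` {y\<in>K. r y < r x})"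
  shows "inj_on v K \<and> vec.independent (v ` K)"
  using assms
proof (induction rule: finite_ranking_induct[where f=r])
  case (insert x S)
  show ?case
  proof (cases "x \<in> S")
    case True
    then show ?thesis using insert by (simp add: insert_absorb)
  next
    case False
    have lt: "r y < r x" if "y \<in> S" for y
      using insert.hyps(2)[OF that] insert.prems(1) that False by (metis inj_on_def insertCI le_neq_implies_less)
    have "{y \<in> insert x S. r y < r x} = S" using lt by auto
    then have nx: "v x \<notin> vec.span (v ` S)"
      using insert.prems(2)[of x] by simp
    have "inj_on v S \<and> vec.independent (v ` S)"
    proof (rule insert.IH)
      show "inj_on r S" using insert.prems(1) by (simp add: inj_on_def)
      fix z assume "z \<in> S"
      then have "v z \<notin> vec.span (v ` {y \<in> insert x S. r y < r z})" using insert.prems(2)[of z] by simp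
      moreover have "v ` {y \<in> S. r y < r z} \<subseteq> v ` {y \<in> insert x S. r y < r z}" by auto
      ultimately show "v z \<notin> vec.span (v ` {y \<in> S. r y < r z})" using vec.span_mono by blast
    qed
    moreover have "v x \<notin> v ` S" using nx vec.span_base by blast
    ultimately show ?thesis using nx by (auto simp: vec.independent_insert)
  qed
qed (auto simp: vec.independent_empty)

section \<open>Unit upper triangular matrices\<close>

lemma unit_upper_triangular_mult_top:
  fixes U :: "((complex, 'm::{finite,linorder}) vec, 'm) vec"
  assumes "unit_upper_triangular U" "\<And>k. i < k \<Longrightarrow> x $ k = 0"
  shows "(U *v x) $ i = x $ i"
proof -
  have "(U *v x) $ i = (\<Sum>j\<in>UNIV. U $ i $ j * x $ j)" by (simp add: matrix_vector_mult_def)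
  also have "\<dots> = (\<Sum>j\<in>UNIV. if j = i then x $ i else 0)"
    using assms unfolding unit_upper_triangular_def
    by (intro sum.cong) (auto, metis linorder_less_linear)
  finally show ?thesis by simp
qed

text \<open>Back substitution: at the largest index above \<open>i\<close> with a nonzero
  coordinate, \<open>U\<close> would reproduce that coordinate.\<close>

lemma unit_upper_triangular_mult_zero_above:
  fixes U :: "((complex, 'm::{finite,linorder}) vec, 'm) vec"
  assumes "unit_upper_triangular U" "\<And>k. i < k \<Longrightarrow> (U *v x) $ k = 0" "i < k"
  shows "x $ k = 0"
proof (rule ccontr)
  assume k: "x $ k \<noteq> 0"
  let ?Z = "{k. i < k \<and> x $ k \<noteq> 0}"
  have Z: "?Z \<noteq> {}" using k assms(3) by auto
  then have m: "Max ?Z \<in> ?Z" by (intro Max_in) auto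
  have "x $ l = 0" if "Max ?Z < l" for l
    using that m Max_ge[of ?Z l] by (fastforce dest: leD)
  then have "(U *v x) $ Max ?Z = x $ Max ?Z"
    by (rule unit_upper_triangular_mult_top[OF assms(1)])
  then show False using assms(2) m by auto
qed

text \<open>The kernel is trivial: back substitution kills every coordinate above the least index,
  and then the coordinate at the least index as well.\<close>

lemma unit_upper_triangular_invertible:
  fixes U :: "((complex, 'm::{finite,linorder}) vec, 'm) vec"
  assumes "unit_upper_triangular U"
  shows "invertible U"
proof -
  have "x = 0" if "U *v x = 0" for x
  proof -
    have 1: "x $ k = 0" if "Min UNIV < k" for k
      using unit_upper_triangular_mult_zero_above[OF assms _ that] \<open>U *v x = 0\<close> by simp
    then have "x $ Min UNIV = 0"
      using unit_upper_triangular_mult_top[OF assms, of "Min UNIV" x] \<open>U *v x = 0\<close> by simp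
    moreover have "k = Min UNIV \<or> Min UNIV < k" for k :: 'm
      by (metis Min_le UNIV_I finite order_le_less)
    ultimately show ?thesis using 1 by (metis vec_eq_iff zero_index)
  qed
  then show ?thesis
    by (metis invertible_def matrix_left_right_inverse matrix_left_invertible_ker)
qed

text \<open>Column \<open>j\<close> of the inverse solves \<open>U *v x = axis j 1\<close>, whose
  right-hand side vanishes above index \<open>j\<close>; back substitution gives the same shape for
  the solution.\<close>

lemma unit_upper_triangular_matrix_inv:
  fixes U :: "((complex, 'm::{finite,linorder}) vec, 'm) vec"
  assumes "unit_upper_triangular U"
  shows "unit_upper_triangular (matrix_inv U)"
proof -
  have col: "U *v column j (matrix_inv U) = axis j 1" for j
    by (metis assms unit_upper_triangular_invertible matrix_inv_mult(1) matrix_vector_mul_assoc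
        matrix_vector_mul_lid matrix_vector_mult_axis)
  have z: "column j (matrix_inv U) $ i = 0" if "j < i" for i j
    by (rule unit_upper_triangular_mult_zero_above[OF assms _ that]) (auto simp: col axis_def)
  have "column j (matrix_inv U) $ j = 1" for j
    using unit_upper_triangular_mult_top[OF assms, of j "column j (matrix_inv U)"] z
    by (simp add: col axis_def)
  with z show ?thesis by (auto simp: unit_upper_triangular_def column_def)
qed

section \<open>Uniformly closed subspaces of functions\<close>

text \<open>The functions are total, but closeness is measured on \<open>P\<close> only; membership
  in such a \<open>V\<close> therefore depends only on the values on \<open>P\<close>.\<close>

definition unif_closed_subspace :: "'a set \<Rightarrow> ('a \<Rightarrow> complex^'n) set \<Rightarrow> bool" where
  "unif_closed_subspace P V \<longleftrightarrow>
     (\<lambda>_. 0) \<in> V \<and>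
     (\<forall>f\<in>V. \<forall>g\<in>V. (\<lambda>t. f t + g t) \<in> V) \<and>
     (\<forall>c. \<forall>f\<in>V. (\<lambda>t. c *s f t) \<in> V) \<and>
     (\<forall>h. (\<forall>\<epsilon>>0. \<exists>f\<in>V. \<forall>t\<in>P. norm (f t - h t) \<le> \<epsilon>) \<longrightarrow> h \<in> V)"

text \<open>Applied to the reachable functions of either time notion, this turns ensemble
  reachability into the statement that all continuous functions belong to the closure.\<close>

definition unif_closure :: "'a set \<Rightarrow> ('a \<Rightarrow> complex^'n) set \<Rightarrow> ('a \<Rightarrow> complex^'n) set" where
  "unif_closure P X = {h. \<forall>\<epsilon>>0. \<exists>f\<in>X. \<forall>t\<in>P. norm (f t - h t) \<le> \<epsilon>}"

lemma unif_closureI: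
  assumes "\<And>\<epsilon>. \<epsilon> > 0 \<Longrightarrow> \<exists>f\<in>X. \<forall>t\<in>P. norm (f t - h t) \<le> \<epsilon>"
  shows "h \<in> unif_closure P X"
  using assms by (simp add: unif_closure_def)

lemma unif_closureD:
  assumes "h \<in> unif_closure P X" "\<epsilon> > 0"
  shows "\<exists>f\<in>X. \<forall>t\<in>P. norm (f t - h t) \<le> \<epsilon>"
  using assms unfolding unif_closure_def by blast

lemma unif_closure_incl: "f \<in> X \<Longrightarrow> f \<in> unif_closure P X"
  by (rule unif_closureI) (auto intro!: bexI[of _ f])

lemma unif_closed_subspace_unif_closure:
  fixes X :: "('a \<Rightarrow> complex^'n) set"
  assumes zero: "(\<lambda>_. 0) \<in> X"
    and add: "\<And>f g. f \<in> X \<Longrightarrow> g \<in> X \<Longrightarrow> (\<lambda>t. f t + g t) \<in> X"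
    and scale: "\<And>c f. f \<in> X \<Longrightarrow> (\<lambda>t. c *s f t) \<in> X"
  shows "unif_closed_subspace P (unif_closure P X)"
  unfolding unif_closed_subspace_def
proof (intro conjI ballI allI impI)
  show "(\<lambda>_. 0) \<in> unif_closure P X" by (rule unif_closure_incl[OF zero])
next
  fix f g assume fg: "f \<in> unif_closure P X" "g \<in> unif_closure P X"
  show "(\<lambda>t. f t + g t) \<in> unif_closure P X"
  proof (rule unif_closureI)
    fix \<epsilon> :: real assume e: "\<epsilon> > 0"
    then have e2: "\<epsilon> / 2 > 0" by simp
    obtain f' where f': "f' \<in> X" "\<And>t. t \<in> P \<Longrightarrow> norm (f' t - f t) \<le> \<epsilon> / 2"
      using unif_closureD[OF fg(1) e2] by blast
    obtain g' where g': "g' \<in> X" "\<And>t. t \<in> P \<Longrightarrow> norm (g' t - g t) \<le> \<epsilon> / 2"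
      using unif_closureD[OF fg(2) e2] by blast
    have "norm (f' t + g' t - (f t + g t)) \<le> \<epsilon>" if "t \<in> P" for t
      using f'(2)[OF that] g'(2)[OF that] norm_triangle_ineq[of "f' t - f t" "g' t - g t"]
      by (simp add: algebra_simps)
    then show "\<exists>h\<in>X. \<forall>t\<in>P. norm (h t - (f t + g t)) \<le> \<epsilon>"
      using add[OF f'(1) g'(1)] by (intro bexI[of _ "\<lambda>t. f' t + g' t"]) auto
  qed
next
  fix c f assume f: "f \<in> unif_closure P X"
  show "(\<lambda>t. c *s f t) \<in> unif_closure P X"
  proof (rule unif_closureI)
    fix \<epsilon> :: real assume e: "\<epsilon> > 0"
    \<comment> \<open>The summand 1 keeps the denominator positive when
      \<open>c = 0\<close>.\<close>
    then have e': "\<epsilon> / (norm c + 1) > 0" by (simp add: add_nonneg_pos)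
    obtain f' where f': "f' \<in> X" "\<And>t. t \<in> P \<Longrightarrow> norm (f' t - f t) \<le> \<epsilon> / (norm c + 1)"
      using unif_closureD[OF f e'] by blast
    have "norm (c *s f' t - c *s f t) \<le> \<epsilon>" if "t \<in> P" for t
    proof -
      have "norm (c *s f' t - c *s f t) = norm c * norm (f' t - f t)"
        by (metis norm_scaleC_vec vec.scale_right_diff_distrib)
      also have "\<dots> \<le> (norm c + 1) * (\<epsilon> / (norm c + 1))"
        using f'(2)[OF that] by (intro mult_mono) auto
      also have "\<dots> = \<epsilon>" by (simp add: add_nonneg_eq_0_iff)
      finally show ?thesis .
    qed
    then show "\<exists>h\<in>X. \<forall>t\<in>P. norm (h t - c *s f t) \<le> \<epsilon>"
      using scale[OF f'(1)] by (intro bexI[of _ "\<lambda>t. c *s f' t"]) auto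
  qed
next
  fix h assume h: "\<forall>\<epsilon>>0. \<exists>f\<in>unif_closure P X. \<forall>t\<in>P. norm (f t - h t) \<le> \<epsilon>"
  show "h \<in> unif_closure P X"
  proof (rule unif_closureI)
    fix \<epsilon> :: real assume e: "\<epsilon> > 0"
    then have e2: "\<epsilon> / 2 > 0" by simp
    then obtain f where f: "f \<in> unif_closure P X" "\<And>t. t \<in> P \<Longrightarrow> norm (f t - h t) \<le> \<epsilon>/2"
      using h by blast
    obtain f' where f': "f' \<in> X" "\<And>t. t \<in> P \<Longrightarrow> norm (f' t - f t) \<le> \<epsilon>/2"
      using unif_closureD[OF f(1) e2] by blast
    have "norm (f' t - h t) \<le> \<epsilon>" if "t \<in> P" for t
      using f'(2)[OF that] f(2)[OF that] norm_triangle_ineq[of "f' t - f t" "f t - h t"] by simp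
    with f'(1) show "\<exists>f\<in>X. \<forall>t\<in>P. norm (f t - h t) \<le> \<epsilon>" by blast
  qed
qed

context
  fixes P :: "'a set" and V :: "('a \<Rightarrow> complex^'n) set"
  assumes V: "unif_closed_subspace P V"
begin

lemma ucs_add: "f \<in> V \<Longrightarrow> g \<in> V \<Longrightarrow> (\<lambda>t. f t + g t) \<in> V"
  using V by (simp add: unif_closed_subspace_def)

lemma ucs_scale: "f \<in> V \<Longrightarrow> (\<lambda>t. c *s f t) \<in> V"
  using V by (simp add: unif_closed_subspace_def)

lemma ucs_scaleR: "f \<in> V \<Longrightarrow> (\<lambda>t. c *\<^sub>R f t) \<in> V"
  using ucs_scale[of f "of_real c"] by (simp add: scaleR_eq_of_real_smult)

lemma ucs_diff: "f \<in> V \<Longrightarrow> g \<in> V \<Longrightarrow> (\<lambda>t. f t - g t) \<in> V"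
  using ucs_add[of f "\<lambda>t. (-1) *s g t"] ucs_scale[of g "-1"] by simp

lemma ucs_sum:
  assumes "\<And>i. i \<in> I \<Longrightarrow> f i \<in> V"
  shows "(\<lambda>t. \<Sum>i\<in>I. f i t) \<in> V"
  using assms
proof (induction I rule: infinite_finite_induct)
  case (insert x F)
  then show ?case using ucs_add[of "f x" "\<lambda>t. \<Sum>i\<in>F. f i t"] by simp
qed (use V in \<open>auto simp: unif_closed_subspace_def\<close>)

lemma ucs_closed:
  assumes "\<And>\<epsilon>. \<epsilon> > 0 \<Longrightarrow> \<exists>f\<in>V. \<forall>t\<in>P. norm (f t - h t) \<le> \<epsilon>"
  shows "h \<in> V"
  using V assms by (simp add: unif_closed_subspace_def)

lemma ucs_cong:
  assumes "f \<in> V" "\<And>t. t \<in> P \<Longrightarrow> f t = h t"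
  shows "h \<in> V"
  by (rule ucs_closed) (use assms in \<open>auto intro!: bexI[of _ f]\<close>)

end

section \<open>Density of polynomial multiples along the arc\<close>

text \<open>A continuous injection from a compact interval is a homeomorphism onto its image, which
  makes the parameter \<open>g\<close> a continuous real function on \<open>P\<close>.\<close>

lemma arc_inverse:
  fixes P :: "complex set"
  assumes "jordan_arc P"
  obtains \<gamma> :: "real \<Rightarrow> complex" and g where "continuous_on {0..1} \<gamma>" "continuous_on P g"
    "\<And>t. t \<in> P \<Longrightarrow> g t \<in> {0..1} \<and> \<gamma> (g t) = t" "\<gamma> ` {0..1} = P"
proof -
  obtain \<gamma> where g: "arc \<gamma>" "path_image \<gamma> = P"
    using assms by (auto simp: jordan_arc_def)
  then have c: "continuous_on {0..1} \<gamma>" "inj_on \<gamma> {0..1}" "\<gamma> ` {0..1} = P"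
    by (auto simp: arc_def path_def path_image_def)
  obtain h where "homeomorphism {0..1} P \<gamma> h"
    using homeomorphism_compact[of "{0..1}" \<gamma> P] c by auto
  then show ?thesis using c by (intro that[of \<gamma> h]) (auto simp: homeomorphism_def)
qed

text \<open>Pulled back to the unit interval, \<open>h\<close> is uniformly close to a polynomial
  \<open>p\<close>. Then \<open>p (g t)\<close> times \<open>w t\<close> is a combination of the
  given members, and boundedness of \<open>w\<close> on the compact \<open>P\<close> controls the
  error.\<close>

lemma continuous_scaled_mem:
  fixes P :: "complex set" and V :: "(complex \<Rightarrow> complex^'n) set" and g :: "complex \<Rightarrow> real" and h :: "complex \<Rightarrow> real"
  assumes V: "unif_closed_subspace P V"
    and gamma: "continuous_on {0..1} \<gamma>" "\<gamma> ` {0..1} = P"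
    and g: "\<And>t. t \<in> P \<Longrightarrow> g t \<in> {0..1} \<and> \<gamma> (g t) = t"
    and w: "continuous_on P w"
    and mem: "\<And>q. (\<lambda>t. complex_of_real (g t) ^ q *s w t) \<in> V"
    and h: "continuous_on P h"
  shows "(\<lambda>t. h t *\<^sub>R w t) \<in> V"
proof (rule ucs_closed[OF V])
  fix \<epsilon> :: real assume e: "\<epsilon> > 0"
  have "compact (w ` P)"
    using gamma by (metis compact_Icc compact_continuous_image w)
  then obtain C where C: "C > 0" "\<And>t. t \<in> P \<Longrightarrow> norm (w t) \<le> C"
    by (auto dest!: compact_imp_bounded simp: bounded_pos)
  have "continuous_on {0..1} (h \<circ> \<gamma>)"
    using gamma h by (intro continuous_on_compose) auto
  then obtain p where p: "real_polynomial_function p" "\<And>x. x \<in> {0..1} \<Longrightarrow> \<bar>(h \<circ> \<gamma>) x - p x\<bar> < \<epsilon> / C"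
    using Stone_Weierstrass_real_polynomial_function[of "{0..1::real}" "h \<circ> \<gamma>" "\<epsilon> / C"] e C by auto
  obtain a N where a: "p = (\<lambda>x. \<Sum>i\<le>N. a i * x ^ i)"
    using p(1) by (auto simp: real_polynomial_function_iff_sum)
  have "(\<lambda>t. \<Sum>i\<le>N. a i *\<^sub>R (complex_of_real (g t) ^ i *s w t)) \<in> V"
    by (intro ucs_sum[OF V] ucs_scaleR[OF V] mem)
  moreover have "(\<Sum>i\<le>N. a i *\<^sub>R (complex_of_real (g t) ^ i *s w t)) = p (g t) *\<^sub>R w t" for t
    by (simp add: a scaleR_sum_left scaleR_eq_of_real_smult vec.scale_sum_left)
  ultimately have "(\<lambda>t. p (g t) *\<^sub>R w t) \<in> V" by simp
  moreover have "norm (p (g t) *\<^sub>R w t - h t *\<^sub>R w t) \<le> \<epsilon>" if t: "t \<in> P" for t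
  proof -
    have "norm (p (g t) *\<^sub>R w t - h t *\<^sub>R w t) = \<bar>h t - p (g t)\<bar> * norm (w t)"
      by (metis abs_minus_commute norm_scaleR scaleR_left_diff_distrib)
    also have "\<dots> \<le> (\<epsilon> / C) * C"
      using p(2)[of "g t"] g[OF t] C(2)[OF t] e C(1) by (intro mult_mono) auto
    finally show ?thesis using C by simp
  qed
  ultimately show "\<exists>f\<in>V. \<forall>t\<in>P. norm (f t - h t *\<^sub>R w t) \<le> \<epsilon>"
    by (intro bexI[of _ "\<lambda>t. p (g t) *\<^sub>R w t"]) auto
qed

text \<open>The approximation above is for real coefficients; this splitting transfers it to complex
  ones.\<close>

lemma Re_Im_smult:
  fixes v :: "complex^'n"
  shows "Re z *\<^sub>R v + \<i> *s (Im z *\<^sub>R v) = z *s v"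
proof -
  have "Re z *\<^sub>R v + \<i> *s (Im z *\<^sub>R v) = (of_real (Re z) + \<i> * of_real (Im z)) *s v"
    by (simp only: scaleR_eq_of_real_smult vec.scale_left_distrib vec.scale_scale)
  then show ?thesis by (simp only: complex_eq[of z, symmetric])
qed

text \<open>The coordinates of \<open>f t\<close> in the basis of columns of \<open>W t\<close> are
  continuous in \<open>t\<close>, since inversion is; each coordinate multiple of a column lies in
  \<open>V\<close> by approximation.\<close>

lemma all_continuous_mem:
  fixes P :: "complex set" and V :: "(complex \<Rightarrow> complex^'n) set" and W :: "complex \<Rightarrow> complex^'n^'n"
  assumes V: "unif_closed_subspace P V"
    and gamma: "continuous_on {0..1} \<gamma>" "\<gamma> ` {0..1} = P"
    and g: "\<And>t. t \<in> P \<Longrightarrow> g t \<in> {0..1} \<and> \<gamma> (g t) = t"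
    and W: "continuous_on P W" "\<And>t. t \<in> P \<Longrightarrow> invertible (W t)"
    and mem: "\<And>p q. (\<lambda>t. complex_of_real (g t) ^ q *s column p (W t)) \<in> V"
    and f: "continuous_on P f"
  shows "f \<in> V"
proof -
  define c where "c = (\<lambda>t. matrix_inv (W t) *v f t)"
  have c: "continuous_on P c"
    unfolding c_def by (intro continuous_on_matrix_vector_mult continuous_on_matrix_inv W f)
  have 1: "(\<lambda>t. h t *\<^sub>R column p (W t)) \<in> V" if "continuous_on P h" for h p
    by (rule continuous_scaled_mem[OF V gamma g continuous_on_column[OF W(1)] mem that])
  have "(\<lambda>t. \<Sum>p\<in>UNIV. Re (c t $ p) *\<^sub>R column p (W t) + \<i> *s (Im (c t $ p) *\<^sub>R column p (W t))) \<in> V"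
    by (intro ucs_sum[OF V] ucs_add[OF V] ucs_scale[OF V] 1 continuous_intros c)
  then show ?thesis
  proof (rule ucs_cong[OF V])
    fix t assume t: "t \<in> P"
    have "(\<Sum>p\<in>UNIV. Re (c t $ p) *\<^sub>R column p (W t) + \<i> *s (Im (c t $ p) *\<^sub>R column p (W t)))
        = (\<Sum>p\<in>UNIV. c t $ p *s column p (W t))"
      by (simp only: Re_Im_smult)
    also have "\<dots> = W t *v c t" by (simp add: matrix_mult_sum)
    also have "\<dots> = f t" by (simp add: c_def matrix_vector_mul_assoc matrix_inv_mult W(2)[OF t])
    finally show "(\<Sum>p\<in>UNIV. Re (c t $ p) *\<^sub>R column p (W t) + \<i> *s (Im (c t $ p) *\<^sub>R column p (W t))) = f t" .
  qed
qed

section \<open>The structure of Kronecker indices\<close>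

definition krylov :: "complex^'n^'n \<Rightarrow> complex^'m^'n \<Rightarrow> nat \<times> 'm \<Rightarrow> complex^'n" where
  "krylov A B x = mpow A (fst x) *v column (snd x) B"

text \<open>An order-preserving numbering of the list \<open>b\<^sub>1,\<dots>,b\<^sub>m,A b\<^sub>1,\<dots>\<close>, so that inductions along the list
  become inductions on natural numbers.\<close>

definition list_pos :: "nat \<times> 'm::{finite,linorder} \<Rightarrow> nat" where
  "list_pos x = fst x * CARD('m) + card {j. j < snd x}"

text \<open>The offset \<open>card {j. j < i}\<close> within a row is smaller than
  \<open>CARD('m)\<close> and strictly increasing in \<open>i\<close>, so rows occupy disjoint
  consecutive blocks.\<close>

lemma list_pos_less_iff: "list_pos (l, j) < list_pos (k, i) \<longleftrightarrow> l < k \<or> (l = k \<and> j < i)"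
  for i j :: "'m::{finite,linorder}"
proof -
  have lt: "card {j'. j' < j} < CARD('m)" for j :: 'm
    by (rule psubset_card_mono) auto
  have 1: "list_pos (l, j) < list_pos (k, i)" if "l < k" for l k and i j :: 'm
  proof -
    have "list_pos (l, j) < Suc l * CARD('m)" using lt[of j] by (simp add: list_pos_def)
    also have "\<dots> \<le> k * CARD('m)" using that by (intro mult_right_mono) auto
    finally show ?thesis by (simp add: list_pos_def)
  qed
  have 2: "list_pos (l, j) < list_pos (l, i)" if "j < i" for l and i j :: 'm
    using that unfolding list_pos_def by (auto intro!: psubset_card_mono)
  show ?thesis
    using 1[of l k j i] 1[of k l i j] 2[of j i l] 2[of i j l]
    by (metis (no_types) less_asym linorder_less_linear less_irrefl)
qed

lemma inj_list_pos: "inj (list_pos :: nat \<times> 'm::{finite,linorder} \<Rightarrow> nat)"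
proof (rule injI)
  fix x y :: "nat \<times> 'm" assume "list_pos x = list_pos y"
  then have "\<not> list_pos x < list_pos y" "\<not> list_pos y < list_pos x" by auto
  then show "x = y"
    using list_pos_less_iff[of "fst x" "snd x" "fst y" "snd y"] list_pos_less_iff[of "fst y" "snd y" "fst x" "snd x"]
    by (metis linorder_less_linear prod.collapse)
qed

definition preceding_span :: "complex^'n^'n \<Rightarrow> complex^'m::{finite,linorder}^'n \<Rightarrow> nat \<times> 'm \<Rightarrow> (complex^'n) set" where
  "preceding_span A B x = vec.span (krylov A B ` {y. list_pos y < list_pos x})"

text \<open>Encoded through the indices alone, so that pairs with equal Kronecker indices have
  literally the same set. For reachable pairs \<open>selected_iff\<close> identifies it with the
  outcome of the selection process.\<close>

definition selected :: "complex^'n^'n \<Rightarrow> complex^'m::{finite,linorder}^'n \<Rightarrow> (nat \<times> 'm) set" where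
  "selected A B = {x. fst x < kronecker_indices A B (snd x)}"

lemma down_closed_eq_lessThan:
  fixes D :: "nat set"
  assumes "finite D" "\<And>k. Suc k \<in> D \<Longrightarrow> k \<in> D"
  shows "D = {..<card D}"
proof -
  define m where "m = (LEAST k. k \<notin> D)"
  have ex: "\<exists>k. k \<notin> D" using assms(1) by (meson ex_new_if_finite infinite_UNIV_nat)
  have m: "m \<notin> D" unfolding m_def using ex by (rule LeastI_ex)
  have "k \<in> D" if "k < m" for k using that not_less_Least unfolding m_def by blast
  moreover have "k \<notin> D" if "m \<le> k" for k
    using that by (induction k rule: dec_induct) (use m assms(2) in auto)
  ultimately have "D = {..<m}" by (auto simp: not_le[symmetric])
  then show ?thesis by simp
qed

lemma krylov_Suc: "krylov A B (Suc k, i) = A *v krylov A B (k, i)"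
  by (simp add: krylov_def mpow_Suc_mult_vec del: mpow.simps)

text \<open>Multiplication by \<open>A\<close> moves every list entry down one row and preserves the
  order of the list.\<close>

lemma preceding_span_Suc:
  assumes "x \<in> preceding_span A B (k, i)"
  shows "A *v x \<in> preceding_span A B (Suc k, i)"
  using assms unfolding preceding_span_def
proof (induction rule: vec.span_induct)
  case base
  then show ?case
    by (auto simp: vec.subspace_def matrix_vector_right_distrib vec.span_add vec.span_scale vec.span_zero
        vector_scalar_commute)
next
  case (step x)
  then obtain l j where x: "x = krylov A B (l, j)" "list_pos (l, j) < list_pos (k, i)" by auto
  then show ?case
    by (auto simp: krylov_Suc[symmetric] list_pos_less_iff intro!: vec.span_base imageI)
qed

lemma mem_preceding_span_Suc:
  "krylov A B (k, i) \<in> preceding_span A B (k, i) \<Longrightarrow> krylov A B (Suc k, i) \<in> preceding_span A B (Suc k, i)"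
  by (simp add: krylov_Suc preceding_span_Suc)

lemma kronecker_indices_eq:
  fixes A :: "complex^'n^'n"
  shows "kronecker_indices A B i = card {k. k < CARD('n) \<and> krylov A B (k, i) \<notin> preceding_span A B (k, i)}"
proof -
  have "{mpow A l *v column j B | l j. l < CARD('n) \<and> (l < k \<or> (l = k \<and> j < i))}
      = krylov A B ` {y. list_pos y < list_pos (k, i)}" if "k < CARD('n)" for k
  proof -
    have "krylov A B ` {y. list_pos y < list_pos (k, i)} = {krylov A B (l, j) | l j. l < k \<or> (l = k \<and> j < i)}"
      by (auto simp: list_pos_less_iff[symmetric])
    moreover have "(l < CARD('n) \<and> (l < k \<or> (l = k \<and> j < i))) \<longleftrightarrow> l < k \<or> (l = k \<and> j < i)" for l j
      using that by auto
    ultimately show ?thesis by (simp add: krylov_def)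
  qed
  then show ?thesis
    unfolding kronecker_indices_def preceding_span_def
    by (intro arg_cong[where f=card] Collect_cong conj_cong) (auto simp: krylov_def)
qed

context
  fixes A :: "complex^'n^'n" and B :: "complex^'m::{finite,linorder}^'n"
  assumes reach: "reachable A B"
begin

text \<open>A rejected power stays rejected in later rows, so the selected powers below
  \<open>CARD('n)\<close> form an initial segment, determined by its cardinality. From row
  \<open>CARD('n)\<close> on, reachability makes the preceding span the whole space and nothing is
  selected.\<close>

lemma selected_iff: "x \<in> selected A B \<longleftrightarrow> krylov A B x \<notin> preceding_span A B x"
proof -
  obtain k i where x: "x = (k, i)" by (cases x)
  define D where "D = {k. k < CARD('n) \<and> krylov A B (k, i) \<notin> preceding_span A B (k, i)}"
  have D: "D = {..<kronecker_indices A B i}"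
    unfolding kronecker_indices_eq D_def
    by (rule down_closed_eq_lessThan) (auto dest: mem_preceding_span_Suc)
  have "krylov A B (k, i) \<in> preceding_span A B (k, i)" if "CARD('n) \<le> k"
  proof -
    have "{mpow A k *v column i B | k i. k < CARD('n)} \<subseteq> krylov A B ` {y. list_pos y < list_pos (k, i)}"
      using that by (auto simp: krylov_def list_pos_less_iff intro!: image_eqI[of _ _ "(_, _)"])
    then show ?thesis
      using reach vec.span_mono unfolding reachable_def preceding_span_def by blast
  qed
  then have "krylov A B (k, i) \<notin> preceding_span A B (k, i) \<longleftrightarrow> k \<in> D"
    by (auto simp: D_def not_le[symmetric])
  then show ?thesis by (simp add: x D selected_def)
qed

lemma finite_selected: "finite (selected A B)"
proof -
  have "selected A B = (\<Union>i. (\<lambda>k. (k, i)) ` {..<kronecker_indices A B i})"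
    by (auto simp: selected_def image_iff)
  then show ?thesis by simp
qed

text \<open>Strong induction along the list: a rejected vector is a combination of earlier ones,
  which are already covered.\<close>

lemma krylov_mem_span_selected:
  "krylov A B x \<in> vec.span (krylov A B ` {y \<in> selected A B. list_pos y \<le> list_pos x})"
proof (induction "list_pos x" arbitrary: x rule: less_induct)
  case less
  show ?case
  proof (cases "x \<in> selected A B")
    case True
    then show ?thesis by (intro vec.span_base imageI) simp
  next
    case False
    then have "krylov A B x \<in> vec.span (krylov A B ` {y. list_pos y < list_pos x})"
      by (simp add: selected_iff preceding_span_def)
    moreover have "krylov A B ` {y. list_pos y < list_pos x} \<subseteq> vec.span (krylov A B ` {y \<in> selected A B. list_pos y \<le> list_pos x})"
    proof clarify
      fix l and j :: 'm assume y: "list_pos (l, j) < list_pos x"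
      have "krylov A B ` {y \<in> selected A B. list_pos y \<le> list_pos (l, j)} \<subseteq> krylov A B ` {y \<in> selected A B. list_pos y \<le> list_pos x}"
        using y by auto
      then show "krylov A B (l, j) \<in> vec.span (krylov A B ` {y \<in> selected A B. list_pos y \<le> list_pos x})"
        using less[OF y] vec.span_mono by blast
    qed
    ultimately show ?thesis
      using vec.span_minimal[OF _ vec.subspace_span] by blast
  qed
qed

lemma preceding_span_eq:
  "preceding_span A B x = vec.span (krylov A B ` {y \<in> selected A B. list_pos y < list_pos x})"
proof
  have "krylov A B ` {y. list_pos y < list_pos x} \<subseteq> vec.span (krylov A B ` {y \<in> selected A B. list_pos y < list_pos x})"
  proof clarify
    fix l and j :: 'm assume y: "list_pos (l, j) < list_pos x"
    have "krylov A B ` {y \<in> selected A B. list_pos y \<le> list_pos (l, j)} \<subseteq> krylov A B ` {y \<in> selected A B. list_pos y < list_pos x}"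
      using y by auto
    then show "krylov A B (l, j) \<in> vec.span (krylov A B ` {y \<in> selected A B. list_pos y < list_pos x})"
      using krylov_mem_span_selected[of "(l, j)"] vec.span_mono by blast
  qed
  then show "preceding_span A B x \<subseteq> vec.span (krylov A B ` {y \<in> selected A B. list_pos y < list_pos x})"
    unfolding preceding_span_def by (rule vec.span_minimal[OF _ vec.subspace_span])
  show "vec.span (krylov A B ` {y \<in> selected A B. list_pos y < list_pos x}) \<subseteq> preceding_span A B x"
    unfolding preceding_span_def by (intro vec.span_mono) auto
qed

lemma span_selected: "vec.span (krylov A B ` selected A B) = UNIV"
proof -
  have "{mpow A k *v column i B | k i. k < CARD('n)} \<subseteq> vec.span (krylov A B ` selected A B)"
  proof clarify
    fix k and i :: 'm
    have "krylov A B ` {y \<in> selected A B. list_pos y \<le> list_pos (k, i)} \<subseteq> krylov A B ` selected A B" by auto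
    then have "krylov A B (k, i) \<in> vec.span (krylov A B ` selected A B)"
      using krylov_mem_span_selected[of "(k, i)"] vec.span_mono by blast
    then show "mpow A k *v column i B \<in> vec.span (krylov A B ` selected A B)" by (simp add: krylov_def)
  qed
  then show ?thesis
    using reach vec.span_minimal[OF _ vec.subspace_span] unfolding reachable_def by blast
qed

text \<open>The selected vectors form a basis. The count allows them to be enumerated by the index
  type \<open>'n\<close> and used as columns of a square matrix.\<close>

lemma card_selected: "card (selected A B) = CARD('n)"
proof -
  have *: "inj_on (krylov A B) (selected A B) \<and> vec.independent (krylov A B ` selected A B)"
  proof (rule independent_rankI[OF finite_selected inj_on_subset[OF inj_list_pos subset_UNIV]])
    fix x assume "x \<in> selected A B"
    then show "krylov A B x \<notin> vec.span (krylov A B ` {y \<in> selected A B. list_pos y < list_pos x})"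
      using selected_iff[of x] preceding_span_eq[of x] by simp
  qed
  then have "card (selected A B) = card (krylov A B ` selected A B)" by (simp add: card_image)
  also have "\<dots> = vec.dim (UNIV :: (complex^'n) set)"
    using vec.basis_card_eq_dim[of "krylov A B ` selected A B" UNIV] * span_selected by simp
  finally show ?thesis by (simp add: card_cart_basis)
qed

text \<open>The change from the selected vectors to \<open>w\<close> is unitriangular along the
  list, so it can be undone by induction on the position.\<close>

lemma span_triangular:
  assumes "\<And>x. x \<in> selected A B \<Longrightarrow> w x - krylov A B x \<in> preceding_span A B x"
  shows "vec.span (w ` selected A B) = UNIV"
proof -
  have "krylov A B x \<in> vec.span (w ` selected A B)" if "x \<in> selected A B" for x
    using that
  proof (induction "list_pos x" arbitrary: x rule: less_induct)
    case less
    have "krylov A B ` {y \<in> selected A B. list_pos y < list_pos x} \<subseteq> vec.span (w ` selected A B)"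
      using less.hyps by auto
    then have "w x - krylov A B x \<in> vec.span (w ` selected A B)"
      using assms[OF less.prems] vec.span_minimal[OF _ vec.subspace_span] unfolding preceding_span_eq by blast
    moreover have "w x \<in> vec.span (w ` selected A B)" using less.prems by (intro vec.span_base) auto
    ultimately have "w x - (w x - krylov A B x) \<in> vec.span (w ` selected A B)" by (rule vec.span_diff[rotated])
    then show ?case by simp
  qed
  then have "krylov A B ` selected A B \<subseteq> vec.span (w ` selected A B)" by auto
  then show ?thesis
    using span_selected vec.span_minimal[OF _ vec.subspace_span] by blast
qed

end

section \<open>Matrices with prescribed columns\<close>

definition column_matrix :: "('p \<Rightarrow> complex^'n) \<Rightarrow> complex^'p^'n" where
  "column_matrix v = (\<chi> i p. v p $ i)"

lemma column_column_matrix [simp]: "column p (column_matrix v) = v p"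
  by (simp add: column_matrix_def column_def vec_eq_iff)

lemma continuous_on_column_matrix:
  fixes v :: "'p::finite \<Rightarrow> 'a::topological_space \<Rightarrow> complex^'n"
  assumes "\<And>p. continuous_on P (v p)"
  shows "continuous_on P (\<lambda>t. column_matrix (\<lambda>p. v p t))"
  unfolding column_matrix_def using assms by (auto intro!: continuous_intros)

lemma columns_column_matrix:
  fixes v :: "'p::finite \<Rightarrow> complex^'n"
  shows "columns (column_matrix v) = range v"
  by (auto simp: columns_def)

lemma matrix_inv_mult_column:
  fixes M :: "complex^'n^'n"
  assumes "invertible M"
  shows "matrix_inv M *v column p M = axis p 1"
  by (simp add: matrix_vector_mult_axis[symmetric] matrix_vector_mul_assoc matrix_inv_mult assms)

section \<open>Normalised chains\<close>

text \<open>The state trajectory of the discrete-time system started at zero and driven by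
  \<open>c\<close>, with \<open>c 0\<close> entering at the first step.\<close>

primrec chain :: "complex^'n^'n \<Rightarrow> complex^'m^'n \<Rightarrow> (nat \<Rightarrow> complex^'m) \<Rightarrow> nat \<Rightarrow> complex^'n" where
  "chain A B c 0 = B *v c 0"
| "chain A B c (Suc l) = A *v chain A B c l + B *v c (Suc l)"

lemma chain_eq_sum: "chain A B c l = (\<Sum>q\<le>l. mpow A (l - q) *v (B *v c q))"
proof (induction l)
  case (Suc l)
  have "A *v (\<Sum>q\<le>l. mpow A (l - q) *v (B *v c q)) = (\<Sum>q\<le>l. mpow A (Suc l - q) *v (B *v c q))"
    unfolding vec.linear_sum[OF matrix_vector_mul_linear_gen]
    by (intro sum.cong refl) (simp add: Suc_diff_le mpow_Suc_mult_vec del: mpow.simps)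
  then show ?case using Suc by simp
qed simp

lemma continuous_on_chain:
  assumes "continuous_on P A" "continuous_on P B" "\<And>q. continuous_on P (\<lambda>t. c t q)"
  shows "continuous_on P (\<lambda>t. chain (A t) (B t) (c t) l)"
  by (induction l) (auto intro!: continuous_on_matrix_vector_mult continuous_intros assms)

section \<open>Reachable functions in discrete time\<close>

text \<open>\<open>v k\<close> is paired with the power \<open>k\<close>, hence is the time reversal
  of the input in \<open>uer_dt\<close>. Vanishing from \<open>T\<close> on allows inputs with
  different horizons to be added.\<close>

definition reach_dt :: "(complex \<Rightarrow> complex^'n^'n) \<Rightarrow> (complex \<Rightarrow> complex^'m^'n) \<Rightarrow> (complex \<Rightarrow> complex^'n) set" where
  "reach_dt A B = {(\<lambda>t. \<Sum>k<T. mpow (A t) k *v (B t *v v k)) | T v. \<forall>k\<ge>T. v k = 0}"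

lemma reach_dt_extend:
  fixes v :: "nat \<Rightarrow> complex^'m" and B :: "complex^'m^'n"
  assumes "\<forall>k\<ge>T. v k = 0" "T \<le> S"
  shows "(\<Sum>k<T. mpow A k *v (B *v v k)) = (\<Sum>k<S. mpow A k *v (B *v v k))"
  by (rule sum.mono_neutral_left) (use assms in auto)

lemma unif_closed_subspace_reach_dt: "unif_closed_subspace P (unif_closure P (reach_dt A B))"
proof (rule unif_closed_subspace_unif_closure)
  show "(\<lambda>_. 0) \<in> reach_dt A B"
    unfolding reach_dt_def by (auto intro!: exI[of _ 0] exI[of _ "\<lambda>_. 0"])
next
  fix f g assume "f \<in> reach_dt A B" "g \<in> reach_dt A B"
  then obtain T v S w where fg: "f = (\<lambda>t. \<Sum>k<T. mpow (A t) k *v (B t *v v k))" "\<forall>k\<ge>T. v k = 0"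
      "g = (\<lambda>t. \<Sum>k<S. mpow (A t) k *v (B t *v w k))" "\<forall>k\<ge>S. w k = 0"
    unfolding reach_dt_def by auto
  let ?R = "max T S"
  have "f t + g t = (\<Sum>k<?R. mpow (A t) k *v (B t *v (v k + w k)))" for t
    unfolding fg(1,3)
    using reach_dt_extend[OF fg(2), of ?R "A t" "B t"] reach_dt_extend[OF fg(4), of ?R "A t" "B t"]
    by (simp add: sum.distrib matrix_vector_right_distrib)
  moreover have "\<forall>k\<ge>?R. v k + w k = 0" using fg by simp
  ultimately show "(\<lambda>t. f t + g t) \<in> reach_dt A B"
    unfolding reach_dt_def by (auto intro!: exI[of _ ?R] exI[of _ "\<lambda>k. v k + w k"])
next
  fix c f assume "f \<in> reach_dt A B"
  then obtain T v where f: "f = (\<lambda>t. \<Sum>k<T. mpow (A t) k *v (B t *v v k))" "\<forall>k\<ge>T. v k = 0"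
    unfolding reach_dt_def by auto
  then show "(\<lambda>t. c *s f t) \<in> reach_dt A B"
    unfolding reach_dt_def
    by (auto intro!: exI[of _ T] exI[of _ "\<lambda>k. c *s v k"] simp: vec.scale_sum_right vector_scalar_commute)
qed

lemma mpow_column_mem_reach_dt:
  "(\<lambda>t. mpow (A t) k *v column i (B t)) \<in> reach_dt A B"
proof -
  have "mpow (A t) k *v column i (B t) = (\<Sum>l<Suc k. mpow (A t) l *v (B t *v (if l = k then axis i 1 else 0)))" for t
    by (simp add: matrix_vector_mult_axis)
  then show ?thesis
    unfolding reach_dt_def
    by (intro CollectI exI[of _ "Suc k"] exI[of _ "\<lambda>l. if l = k then axis i 1 else 0"]) auto
qed

lemma uer_dtI:
  fixes A :: "complex \<Rightarrow> complex^'n^'n" and B :: "complex \<Rightarrow> complex^'m^'n"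
  assumes "P \<noteq> {}" "\<And>f. continuous_on P f \<Longrightarrow> f \<in> unif_closure P (reach_dt A B)"
  shows "uer_dt P A B"
  unfolding uer_dt_def
proof (intro allI impI)
  fix f :: "complex \<Rightarrow> complex^'n" and \<epsilon> :: real assume f: "continuous_on P f" and e: "\<epsilon> > 0"
  \<comment> \<open>Half of \<epsilon>, because the supremum inherits only the non-strict bound and
    a strict one is required.\<close>
  then obtain h where "h \<in> reach_dt A B" and h: "\<And>t. t \<in> P \<Longrightarrow> norm (h t - f t) \<le> \<epsilon> / 2"
    using unif_closureD[OF assms(2)[OF f], of "\<epsilon> / 2"] by auto
  then obtain T v where hv: "h = (\<lambda>t. \<Sum>k<T. mpow (A t) k *v (B t *v v k))"
    unfolding reach_dt_def by auto
  let ?u = "\<lambda>k. v (T - 1 - k)"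
  have "(\<Sum>k<T. mpow (A t) k *v (B t *v ?u (T - 1 - k))) = h t" for t
    unfolding hv by (intro sum.cong) auto
  then have "(SUP t\<in>P. norm ((\<Sum>k<T. mpow (A t) k *v (B t *v ?u (T - 1 - k))) - f t)) \<le> \<epsilon> / 2"
    using h assms(1) by (intro cSUP_least) auto
  also have "\<dots> < \<epsilon>" using e by simp
  finally show "\<exists>T u. (SUP t\<in>P. norm ((\<Sum>k<T. mpow (A t) k *v (B t *v u (T - 1 - k))) - f t)) < \<epsilon>"
    by (intro exI[of _ T] exI[of _ ?u])
qed

section \<open>The matrix exponential\<close>

lemma norm_mpow_mult_le:
  assumes "\<And>x. norm (A *v x) \<le> R * norm x" "R \<ge> 0"
  shows "norm (mpow A k *v x) \<le> R ^ k * norm x"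
proof (induction k)
  case (Suc k)
  have "norm (A *v (mpow A k *v x)) \<le> R * (R ^ k * norm x)"
    using assms(1)[of "mpow A k *v x"] mult_left_mono[OF Suc assms(2)] by linarith
  then show ?case by (simp add: mpow_Suc_mult_vec mult.assoc del: mpow.simps)
qed simp

lemma ex_matrix_bound:
  fixes A :: "complex^'m^'n"
  obtains R where "R \<ge> 0" "\<And>x. norm (A *v x) \<le> R * norm x"
  by (rule that[of "\<Sum>i\<in>UNIV. \<Sum>j\<in>UNIV. norm (A $ i $ j)"]) (auto intro!: sum_nonneg norm_matrix_vector_mult_le)

lemma mpow_scaleR: "mpow (s *\<^sub>R A) k = s ^ k *\<^sub>R mpow A k"
proof (induction k)
  case (Suc k)
  then show ?case
    by (simp add: vec_eq_iff matrix_matrix_mult_def scaleR_sum_right mult_ac)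
qed simp

text \<open>The entries of \<open>mpow A k\<close> are bounded by \<open>R ^ k\<close>, so each
  entry series in \<open>mexp\<close> converges by comparison with the exponential series; applying
  the matrix to \<open>b\<close> is a finite sum of such series.\<close>

lemma mexp_sums: "(\<lambda>k. (s ^ k / fact k) *\<^sub>R (mpow A k *v b)) sums (mexp (s *\<^sub>R A) *v b)"
proof -
  obtain R where R: "R \<ge> 0" "\<And>x. norm (A *v x) \<le> R * norm x" by (rule ex_matrix_bound[of A]) blast
  have entry: "norm (mpow A k $ i $ j) \<le> R ^ k" for k i j
  proof -
    have "mpow A k $ i $ j = (mpow A k *v axis j 1) $ i"
      by (simp add: matrix_vector_mult_axis column_def)
    also have "norm \<dots> \<le> norm (mpow A k *v axis j 1)" by (rule Finite_Cartesian_Product.norm_nth_le)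
    also have "\<dots> \<le> R ^ k" using norm_mpow_mult_le[OF R(2,1), of k "axis j 1"] by simp
    finally show ?thesis .
  qed
  have sm: "summable (\<lambda>k. mpow (s *\<^sub>R A) k $ i $ j / of_nat (fact k))" for i j
  proof (rule summable_comparison_test')
    show "summable (\<lambda>k. inverse (fact k) * (\<bar>s\<bar> * R) ^ k)" by (rule summable_exp)
    fix k
    have "norm (mpow (s *\<^sub>R A) k $ i $ j / of_nat (fact k)) = \<bar>s\<bar> ^ k * norm (mpow A k $ i $ j) / fact k"
      by (simp add: mpow_scaleR norm_divide power_abs)
    also have "\<dots> \<le> \<bar>s\<bar> ^ k * R ^ k / fact k"
      using entry[of k i j] by (intro divide_right_mono mult_left_mono) auto
    finally show "norm (mpow (s *\<^sub>R A) k $ i $ j / of_nat (fact k)) \<le> inverse (fact k) * (\<bar>s\<bar> * R) ^ k"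
      by (simp add: power_mult_distrib field_simps)
  qed
  have "(\<lambda>k. ((s ^ k / fact k) *\<^sub>R (mpow A k *v b)) $ i) sums ((mexp (s *\<^sub>R A) *v b) $ i)" for i
  proof -
    have "(\<lambda>k. \<Sum>j\<in>UNIV. mpow (s *\<^sub>R A) k $ i $ j / of_nat (fact k) * b $ j) sums
        (\<Sum>j\<in>UNIV. (\<Sum>k. mpow (s *\<^sub>R A) k $ i $ j / of_nat (fact k)) * b $ j)"
      by (intro sums_sum sums_mult2 summable_sums sm)
    moreover have "(\<Sum>j\<in>UNIV. mpow (s *\<^sub>R A) k $ i $ j / of_nat (fact k) * b $ j)
        = ((s ^ k / fact k) *\<^sub>R (mpow A k *v b)) $ i" for k
      by (simp add: mpow_scaleR matrix_vector_mult_def sum_distrib_left sum_divide_distrib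
          scaleR_conv_of_real[where 'a=complex] mult_ac)
    ultimately show ?thesis
      by (simp add: mexp_def matrix_vector_mult_def)
  qed
  then show ?thesis
    unfolding sums_def by (intro vec_tendstoI) simp
qed

text \<open>For \<open>s\<close> in the unit interval \<open>s ^ (k + N)\<close> is at most
  \<open>s ^ N\<close>, so the tail is dominated by \<open>s ^ N * norm b\<close> times the tail of
  the series of \<open>exp R\<close>.\<close>

lemma mexp_taylor:
  assumes R: "\<And>x. norm (A *v x) \<le> R * norm x" "R \<ge> 0" and s: "0 \<le> s" "s \<le> 1"
  shows "norm (mexp (s *\<^sub>R A) *v b - (\<Sum>k<N. (s ^ k / fact k) *\<^sub>R (mpow A k *v b))) \<le> s ^ N * (exp R * norm b)"
proof -
  have "(\<lambda>k. (R ^ k /\<^sub>R fact k)) sums exp R" by (rule exp_converges)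
  then have "(\<lambda>k. R ^ (k + N) /\<^sub>R fact (k + N)) sums (exp R - (\<Sum>k<N. R ^ k /\<^sub>R fact k))"
    by (rule sums_split_initial_segment)
  then have G: "(\<lambda>k. s ^ N * norm b * (R ^ (k + N) /\<^sub>R fact (k + N))) sums (s ^ N * norm b * (exp R - (\<Sum>k<N. R ^ k /\<^sub>R fact k)))"
    by (rule sums_mult)
  have F: "(\<lambda>k. (s ^ (k + N) / fact (k + N)) *\<^sub>R (mpow A (k + N) *v b)) sums
      (mexp (s *\<^sub>R A) *v b - (\<Sum>k<N. (s ^ k / fact k) *\<^sub>R (mpow A k *v b)))"
    by (rule sums_split_initial_segment[OF mexp_sums])
  have le: "norm ((s ^ (k + N) / fact (k + N)) *\<^sub>R (mpow A (k + N) *v b))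
      \<le> s ^ N * norm b * (R ^ (k + N) /\<^sub>R fact (k + N))" for k
  proof -
    have "norm ((s ^ (k + N) / fact (k + N)) *\<^sub>R (mpow A (k + N) *v b))
        = s ^ (k + N) / fact (k + N) * norm (mpow A (k + N) *v b)"
      using s by simp
    also have "\<dots> \<le> s ^ N / fact (k + N) * (R ^ (k + N) * norm b)"
      using s R by (intro mult_mono divide_right_mono power_decreasing norm_mpow_mult_le) auto
    finally show ?thesis by (simp add: field_simps)
  qed
  have "norm (mexp (s *\<^sub>R A) *v b - (\<Sum>k<N. (s ^ k / fact k) *\<^sub>R (mpow A k *v b)))
      \<le> s ^ N * norm b * (exp R - (\<Sum>k<N. R ^ k /\<^sub>R fact k))"
    by (rule norm_sums_le[OF F G le])
  also have "\<dots> \<le> s ^ N * norm b * exp R"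
    using s R(2) by (intro mult_left_mono) (auto intro!: sum_nonneg)
  finally show ?thesis by (simp add: mult_ac)
qed

text \<open>Weierstrass M-test on the unit interval, with the terms of the exponential series of
  \<open>R\<close> as majorants.\<close>

lemma continuous_on_mexp:
  "continuous_on {0..1} (\<lambda>s. mexp (s *\<^sub>R A) *v b)"
proof -
  obtain R where R: "R \<ge> 0" "\<And>x. norm (A *v x) \<le> R * norm x" by (rule ex_matrix_bound[of A]) blast
  have "uniform_limit {0..1} (\<lambda>n s. \<Sum>k<n. (s ^ k / fact k) *\<^sub>R (mpow A k *v b))
      (\<lambda>s. \<Sum>k. (s ^ k / fact k) *\<^sub>R (mpow A k *v b)) sequentially"
  proof (rule Weierstrass_m_test)
    show "summable (\<lambda>k. inverse (fact k) * R ^ k * norm b)"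
      by (intro summable_mult2 summable_exp)
    fix n and s :: real assume s: "s \<in> {0..1}"
    have "norm ((s ^ n / fact n) *\<^sub>R (mpow A n *v b)) = s ^ n / fact n * norm (mpow A n *v b)"
      using s by simp
    also have "\<dots> \<le> 1 / fact n * (R ^ n * norm b)"
      using s R by (intro mult_mono divide_right_mono power_le_one norm_mpow_mult_le) auto
    finally show "norm ((s ^ n / fact n) *\<^sub>R (mpow A n *v b)) \<le> inverse (fact n) * R ^ n * norm b"
      by (simp add: field_simps)
  qed
  then have "continuous_on {0..1} (\<lambda>s. \<Sum>k. (s ^ k / fact k) *\<^sub>R (mpow A k *v b))"
    by (rule uniform_limit_theorem[rotated]) (auto intro!: always_eventually continuous_intros)
  then show ?thesis by (simp add: sums_unique[OF mexp_sums, symmetric])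
qed

text \<open>The Taylor polynomial is integrated termwise; the remainder contributes at most its
  bound at the right endpoint times the length \<open>t\<close>, which gains one power of
  \<open>t\<close>.\<close>

lemma integral_mexp_taylor:
  assumes R: "\<And>x. norm (A *v x) \<le> R * norm x" "R \<ge> 0" and t: "0 \<le> t" "t \<le> 1"
  shows "norm (integral {0..t} (\<lambda>s. mexp (s *\<^sub>R A) *v b) - (\<Sum>k<N. (t ^ Suc k / fact (Suc k)) *\<^sub>R (mpow A k *v b)))
    \<le> t ^ N * (exp R * norm b) * t"
proof -
  have m: "((\<lambda>s. s ^ k / fact k) has_integral t ^ Suc k / fact (Suc k)) {0..t}" for k
  proof -
    have "((\<lambda>s. s ^ Suc k / fact (Suc k)) has_real_derivative s ^ k / fact k) (at s within {0..t})" for s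
    proof -
      have "((\<lambda>s. s ^ Suc k / fact (Suc k)) has_real_derivative real (Suc k) * s ^ k / fact (Suc k)) (at s within {0..t})"
        by (rule DERIV_cdivide) (auto intro!: derivative_eq_intros simp del: of_nat_Suc power_Suc)
      also have "real (Suc k) * s ^ k / fact (Suc k) = s ^ k / fact k" by (simp del: of_nat_Suc)
      finally show ?thesis .
    qed
    then have "((\<lambda>s. s ^ k / fact k) has_integral (t ^ Suc k / fact (Suc k) - 0 ^ Suc k / fact (Suc k))) {0..t}"
      by (intro fundamental_theorem_of_calculus[OF t(1)])
        (simp only: has_real_derivative_iff_has_vector_derivative)
    then show ?thesis by simp
  qed
  have "(\<lambda>s. mexp (s *\<^sub>R A) *v b) integrable_on {0..t}"
    by (intro integrable_continuous_real continuous_on_subset[OF continuous_on_mexp]) (use t in auto)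
  then have "((\<lambda>s. mexp (s *\<^sub>R A) *v b - (\<Sum>k<N. (s ^ k / fact k) *\<^sub>R (mpow A k *v b))) has_integral
      (integral {0..t} (\<lambda>s. mexp (s *\<^sub>R A) *v b) - (\<Sum>k<N. (t ^ Suc k / fact (Suc k)) *\<^sub>R (mpow A k *v b)))) (cbox 0 t)"
    unfolding cbox_interval by (intro has_integral_diff has_integral_sum has_integral_scaleR_left m integrable_integral) auto
  moreover have "norm (mexp (s *\<^sub>R A) *v b - (\<Sum>k<N. (s ^ k / fact k) *\<^sub>R (mpow A k *v b))) \<le> t ^ N * (exp R * norm b)"
    if "s \<in> cbox 0 t" for s
  proof -
    have "s ^ N * (exp R * norm b) \<le> t ^ N * (exp R * norm b)"
      using that by (intro mult_right_mono power_mono) auto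
    moreover have "0 \<le> s" "s \<le> 1" using that t by auto
    ultimately show ?thesis using mexp_taylor[OF R] order_trans by blast
  qed
  ultimately have "norm (integral {0..t} (\<lambda>s. mexp (s *\<^sub>R A) *v b) - (\<Sum>k<N. (t ^ Suc k / fact (Suc k)) *\<^sub>R (mpow A k *v b)))
    \<le> t ^ N * (exp R * norm b) * measure lborel (cbox 0 t)"
    using t(1) by (intro has_integral_bound) auto
  then show ?thesis using t by simp
qed

section \<open>Reachable functions in continuous time\<close>

text \<open>The controls are time-reversed, so that controls on different time horizons can be added after
  extension by zero. The same convention is used in \<^term>\<open>reach_dt\<close>.\<close>

definition reach_ct :: "complex set \<Rightarrow> (complex \<Rightarrow> complex^'n^'n) \<Rightarrow> (complex \<Rightarrow> complex^'m^'n) \<Rightarrow> (complex \<Rightarrow> complex^'n) set" where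
  "reach_ct P A B = {r. \<exists>T>0. \<exists>v. v absolutely_integrable_on UNIV \<and> (\<forall>s. s \<notin> {0..T} \<longrightarrow> v s = 0) \<and>
     (\<forall>t\<in>P. ((\<lambda>s. mexp (s *\<^sub>R A t) *v (B t *v v s)) has_integral r t) UNIV)}"

lemma reach_ctE:
  assumes "r \<in> reach_ct P A B"
  obtains T v where "T > 0" "v absolutely_integrable_on UNIV" "\<forall>s. s \<notin> {0..T} \<longrightarrow> v s = 0"
    "\<forall>t\<in>P. ((\<lambda>s. mexp (s *\<^sub>R A t) *v (B t *v v s)) has_integral r t) UNIV"
  using assms unfolding reach_ct_def mem_Collect_eq by (elim exE conjE)

lemma bounded_linear_smult: "bounded_linear (\<lambda>x::complex^'n. c *s x)"
  by (rule bounded_linear_intro[where K="norm c"])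
    (simp_all add: norm_scaleC_vec vec.scale_right_distrib vec_eq_iff mult.commute)

lemma unif_closed_subspace_reach_ct: "unif_closed_subspace P (unif_closure P (reach_ct P A B))"
proof (rule unif_closed_subspace_unif_closure)
  show "(\<lambda>_. 0) \<in> reach_ct P A B"
    unfolding reach_ct_def by (auto intro!: exI[of _ 1] exI[of _ "\<lambda>_. 0"])
next
  fix f g assume f: "f \<in> reach_ct P A B" and g: "g \<in> reach_ct P A B"
  obtain T v where f: "T > 0" "v absolutely_integrable_on UNIV" "\<forall>s. s \<notin> {0..T} \<longrightarrow> v s = 0"
      "\<forall>t\<in>P. ((\<lambda>s. mexp (s *\<^sub>R A t) *v (B t *v v s)) has_integral f t) UNIV"
    using f by (rule reach_ctE)
  obtain S w where g: "S > 0" "w absolutely_integrable_on UNIV" "\<forall>s. s \<notin> {0..S} \<longrightarrow> w s = 0"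
      "\<forall>t\<in>P. ((\<lambda>s. mexp (s *\<^sub>R A t) *v (B t *v w s)) has_integral g t) UNIV"
    using g by (rule reach_ctE)
  have "((\<lambda>s. mexp (s *\<^sub>R A t) *v (B t *v (v s + w s))) has_integral f t + g t) UNIV" if "t \<in> P" for t
    using has_integral_add[OF f(4)[THEN bspec, OF that] g(4)[THEN bspec, OF that]] by (simp add: matrix_vector_right_distrib)
  then show "(\<lambda>t. f t + g t) \<in> reach_ct P A B"
    unfolding reach_ct_def using f(1-3) g(1-3)
    by (intro CollectI exI[of _ "max T S"] conjI exI[of _ "\<lambda>s. v s + w s"])
      (auto simp: less_max_iff_disj dest!: not_le_imp_less)
next
  fix c f assume "f \<in> reach_ct P A B"
  then obtain T v where f: "T > 0" "v absolutely_integrable_on UNIV" "\<forall>s. s \<notin> {0..T} \<longrightarrow> v s = 0"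
      "\<forall>t\<in>P. ((\<lambda>s. mexp (s *\<^sub>R A t) *v (B t *v v s)) has_integral f t) UNIV"
    by (rule reach_ctE)
  have "((\<lambda>s. mexp (s *\<^sub>R A t) *v (B t *v (c *s v s))) has_integral c *s f t) UNIV" if "t \<in> P" for t
    using has_integral_linear[OF f(4)[THEN bspec, OF that] bounded_linear_smult[of c]] by (simp add: o_def vector_scalar_commute)
  moreover have "(\<lambda>s. c *s v s) absolutely_integrable_on UNIV"
    using absolutely_integrable_linear[OF f(2) bounded_linear_smult[of c]] by (simp add: o_def)
  ultimately show "(\<lambda>t. c *s f t) \<in> reach_ct P A B"
    unfolding reach_ct_def using f(1-3)
    by (intro CollectI exI[of _ T] conjI exI[of _ "\<lambda>s. c *s v s"]) auto
qed

text \<open>This is the response to the constant input \<open>axis i 1\<close> on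
  \<open>{0..\<tau>}\<close>, extended by zero.\<close>

lemma integral_mexp_mem_reach_ct:
  fixes A :: "complex \<Rightarrow> complex^'n^'n" and B :: "complex \<Rightarrow> complex^'m^'n"
  assumes "0 < \<tau>" "\<tau> \<le> 1"
  shows "(\<lambda>t. integral {0..\<tau>} (\<lambda>s. mexp (s *\<^sub>R A t) *v column i (B t))) \<in> reach_ct P A B"
proof -
  define v where "v = (\<lambda>s. if s \<in> {0..\<tau>} then axis i 1 else (0 :: complex^'m))"
  have "v absolutely_integrable_on UNIV"
    unfolding v_def absolutely_integrable_restrict_UNIV
    by (intro absolutely_integrable_continuous_real continuous_intros)
  moreover have "((\<lambda>s. mexp (s *\<^sub>R A t) *v (B t *v v s)) has_integral
      integral {0..\<tau>} (\<lambda>s. mexp (s *\<^sub>R A t) *v column i (B t))) UNIV" for t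
  proof -
    have "(\<lambda>s. mexp (s *\<^sub>R A t) *v column i (B t)) integrable_on {0..\<tau>}"
      by (intro integrable_continuous_real continuous_on_subset[OF continuous_on_mexp]) (use assms in auto)
    then have "((\<lambda>s. if s \<in> {0..\<tau>} then mexp (s *\<^sub>R A t) *v column i (B t) else 0) has_integral
      integral {0..\<tau>} (\<lambda>s. mexp (s *\<^sub>R A t) *v column i (B t))) UNIV"
      by (simp only: has_integral_restrict_UNIV integrable_integral)
    moreover have "(\<lambda>s. if s \<in> {0..\<tau>} then mexp (s *\<^sub>R A t) *v column i (B t) else 0) = (\<lambda>s. mexp (s *\<^sub>R A t) *v (B t *v v s))"
      by (auto simp: v_def matrix_vector_mult_axis)
    ultimately show ?thesis by simp
  qed
  ultimately show ?thesis
    unfolding reach_ct_def using assms(1)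
    by (intro CollectI exI[of _ \<tau>] conjI exI[of _ v]) (auto simp: v_def)
qed

text \<open>The Taylor coefficients of the step response are extracted one after another: the lower
  ones are in the closure by induction and can be subtracted. Compactness of \<open>P\<close> gives
  bounds \<open>R\<close> and \<open>C\<close> independent of \<open>t\<close>, hence a uniform
  remainder.\<close>

lemma mpow_column_mem_reach_ct:
  fixes A :: "complex \<Rightarrow> complex^'n^'n"
  assumes P: "compact P" and A: "continuous_on P A" and B: "continuous_on P B"
  shows "(\<lambda>t. mpow (A t) N *v column i (B t)) \<in> unif_closure P (reach_ct P A B)"
proof (induction N rule: less_induct)
  case (less N)
  let ?V = "unif_closure P (reach_ct P A B)"
  note V = unif_closed_subspace_reach_ct[of P A B]
  define b where "b = (\<lambda>t. column i (B t))"
  define m where "m = (\<lambda>t. \<Sum>i\<in>UNIV. \<Sum>j\<in>UNIV. norm (A t $ i $ j))"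
  have "continuous_on P m" unfolding m_def by (intro continuous_intros A)
  then have "bounded (m ` P)" using P by (intro compact_imp_bounded compact_continuous_image)
  then obtain R where R: "R > 0" "\<And>t. t \<in> P \<Longrightarrow> norm (m t) \<le> R" by (auto simp: bounded_pos)
  have AR: "norm (A t *v x) \<le> R * norm x" if "t \<in> P" for t x
  proof -
    have "norm (A t *v x) \<le> m t * norm x" unfolding m_def by (rule norm_matrix_vector_mult_le)
    also have "\<dots> \<le> R * norm x" using R(2)[OF that] by (intro mult_right_mono) auto
    finally show ?thesis .
  qed
  have "bounded (b ` P)" unfolding b_def
    using P B by (intro compact_imp_bounded compact_continuous_image continuous_on_column)
  then obtain C where C: "C > 0" "\<And>t. t \<in> P \<Longrightarrow> norm (b t) \<le> C" by (auto simp: bounded_pos)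
  show ?case
  proof (rule ucs_closed[OF V])
    fix \<epsilon> :: real assume e: "\<epsilon> > 0"
    \<comment> \<open>After multiplication by \<open>fact (Suc N) / \<tau> ^ Suc N\<close>, the
      remainder of \<open>integral_mexp_taylor\<close> with \<open>Suc N\<close> terms is at most
      \<open>K * \<tau>\<close>; this dictates the choice of \<tau>.\<close>
    define K where "K = fact (Suc N) * (exp R * C)"
    have K: "K > 0" using C by (simp add: K_def)
    define \<tau> where "\<tau> = min 1 (\<epsilon> / K)"
    have \<tau>: "0 < \<tau>" "\<tau> \<le> 1" "K * \<tau> \<le> \<epsilon>"
      using e K by (auto simp: \<tau>_def min_def field_simps)
    define M where "M = (\<lambda>t. integral {0..\<tau>} (\<lambda>s. mexp (s *\<^sub>R A t) *v b t))"
    define h where "h = (\<lambda>t. (fact (Suc N) / \<tau> ^ Suc N) *\<^sub>R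
        (M t - (\<Sum>k<N. (\<tau> ^ Suc k / fact (Suc k)) *\<^sub>R (mpow (A t) k *v b t))))"
    have "M \<in> ?V"
      unfolding M_def b_def by (intro unif_closure_incl integral_mexp_mem_reach_ct \<tau>)
    then have "h \<in> ?V"
      unfolding h_def using less.IH
      by (intro ucs_scaleR[OF V] ucs_diff[OF V] ucs_sum[OF V]) (auto simp: b_def)
    moreover have "norm (h t - mpow (A t) N *v b t) \<le> \<epsilon>" if t: "t \<in> P" for t
    proof -
      \<comment> \<open>The sum has one term more than the one in \<open>h\<close>; after rescaling,
        that term is exactly the target.\<close>
      let ?D = "M t - (\<Sum>k<Suc N. (\<tau> ^ Suc k / fact (Suc k)) *\<^sub>R (mpow (A t) k *v b t))"
      have "h t - mpow (A t) N *v b t = (fact (Suc N) / \<tau> ^ Suc N) *\<^sub>R ?D"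
      proof -
        have "(fact (Suc N) / \<tau> ^ Suc N) *\<^sub>R ((\<tau> ^ Suc N / fact (Suc N)) *\<^sub>R (mpow (A t) N *v b t)) = mpow (A t) N *v b t"
          using \<tau>(1) by (simp del: fact_Suc power_Suc)
        then show ?thesis
          unfolding h_def sum.lessThan_Suc by (simp only: scaleR_diff_right scaleR_add_right diff_diff_eq)
      qed
      then have "norm (h t - mpow (A t) N *v b t) = fact (Suc N) / \<tau> ^ Suc N * norm ?D"
        using \<tau>(1) by simp
      also have "\<dots> \<le> fact (Suc N) / \<tau> ^ Suc N * (\<tau> ^ Suc N * (exp R * norm (b t)) * \<tau>)"
        unfolding M_def using \<tau> R by (intro mult_left_mono integral_mexp_taylor AR[OF t]) auto
      also have "\<dots> = fact (Suc N) * (exp R * norm (b t)) * \<tau>"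
        using \<tau>(1) by (simp del: fact_Suc power_Suc)
      also have "\<dots> \<le> K * \<tau>"
        unfolding K_def using \<tau>(1) C(2)[OF t] by (intro mult_right_mono mult_left_mono) auto
      finally show ?thesis using \<tau>(3) by simp
    qed
    ultimately show "\<exists>f\<in>?V. \<forall>t\<in>P. norm (f t - mpow (A t) N *v column i (B t)) \<le> \<epsilon>"
      by (intro bexI[of _ h]) (auto simp: b_def)
  qed
qed

text \<open>Reflection at 0 followed by translation by \<open>T\<close>; it converts the reversed
  controls back into inputs in forward time.\<close>

lemma has_integral_reverse:
  fixes g :: "real \<Rightarrow> 'b::real_normed_vector"
  assumes "(g has_integral i) {0..T}"
  shows "((\<lambda>s. g (T - s)) has_integral i) {0..T}"
proof -
  have "((\<lambda>s. g (- s)) has_integral i) {-T..0}"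
    using assms has_integral_reflect_real[of g i T 0] by simp
  then have "((\<lambda>s. g (- (s + (- T)))) has_integral i) {0..T}"
    using has_integral_shift_real_ivl[of "\<lambda>s. g (- s)" i "-T" 0 "-T"] by simp
  then show ?thesis by simp
qed

lemma uer_ctI:
  fixes A :: "complex \<Rightarrow> complex^'n^'n" and B :: "complex \<Rightarrow> complex^'m^'n"
  assumes "P \<noteq> {}" "\<And>f. continuous_on P f \<Longrightarrow> f \<in> unif_closure P (reach_ct P A B)"
  shows "uer_ct P A B"
  unfolding uer_ct_def
proof (intro allI impI)
  fix f :: "complex \<Rightarrow> complex^'n" and \<epsilon> :: real assume f: "continuous_on P f" and e: "\<epsilon> > 0"
  then obtain h where hr: "h \<in> reach_ct P A B" and h: "\<And>t. t \<in> P \<Longrightarrow> norm (h t - f t) \<le> \<epsilon> / 2"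
    using unif_closureD[OF assms(2)[OF f], of "\<epsilon> / 2"] by auto
  obtain T v where v: "T > 0" "v absolutely_integrable_on UNIV" "\<forall>s. s \<notin> {0..T} \<longrightarrow> v s = 0"
      "\<forall>t\<in>P. ((\<lambda>s. mexp (s *\<^sub>R A t) *v (B t *v v s)) has_integral h t) UNIV"
    using hr by (rule reach_ctE)
  let ?u = "\<lambda>s. v (T - s)"
  have "v absolutely_integrable_on {0..T}"
  proof -
    have "(\<lambda>s. if s \<in> {0..T} then v s else 0) = v" using v(3) by auto
    then show ?thesis using absolutely_integrable_restrict_UNIV[of "{0..T}" v] v(2) by simp
  qed
  then have u: "?u absolutely_integrable_on {0..T}"
    unfolding absolutely_integrable_on_def
    using has_integral_reverse[of v _ T] has_integral_reverse[of "\<lambda>s. norm (v s)" _ T]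
    by (auto simp: integrable_on_def)
  have "integral {0..T} (\<lambda>s. mexp ((T - s) *\<^sub>R A t) *v (B t *v ?u s)) = h t" if "t \<in> P" for t
  proof -
    let ?g = "\<lambda>s. mexp (s *\<^sub>R A t) *v (B t *v v s)"
    have "(\<lambda>s. if s \<in> {0..T} then ?g s else 0) = ?g" using v(3) by auto
    then have "(?g has_integral h t) {0..T}"
      using v(4)[THEN bspec, OF that] has_integral_restrict_UNIV[of "{0..T}" ?g] by simp
    then show ?thesis using has_integral_reverse[of ?g] by (intro integral_unique) simp
  qed
  then have "(SUP t\<in>P. norm (integral {0..T} (\<lambda>s. mexp ((T - s) *\<^sub>R A t) *v (B t *v ?u s)) - f t)) \<le> \<epsilon> / 2"
    using h assms(1) by (intro cSUP_least) auto
  also have "\<dots> < \<epsilon>" using e by simp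
  finally show "\<exists>T>0. \<exists>u. u absolutely_integrable_on {0..T} \<and>
      (SUP t\<in>P. norm (integral {0..T} (\<lambda>s. mexp ((T - s) *\<^sub>R A t) *v (B t *v u s)) - f t)) < \<epsilon>"
    using v(1) u by (intro exI[of _ T] conjI exI[of _ ?u]) auto
qed

section \<open>Coefficients of the chains\<close>

lemma invertible_column_matrixI:
  fixes w :: "'x \<Rightarrow> complex^'n" and \<beta> :: "'n \<Rightarrow> 'x"
  assumes "bij_betw \<beta> UNIV K" "vec.span (w ` K) = UNIV"
  shows "invertible (column_matrix (\<lambda>p. w (\<beta> p)))"
proof -
  have "range (\<lambda>p. w (\<beta> p)) = w ` K"
    using assms(1) unfolding bij_betw_def by (metis image_image)
  then show ?thesis using assms(2) by (simp add: invertible_iff_span_columns columns_column_matrix)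
qed

definition selected_matrix :: "complex^'n^'n \<Rightarrow> complex^'m^'n \<Rightarrow> ('n \<Rightarrow> nat \<times> 'm) \<Rightarrow> complex^'n^'n" where
  "selected_matrix A B \<beta> = column_matrix (\<lambda>p. krylov A B (\<beta> p))"

text \<open>The coordinate of the first rejected vector of column \<open>i\<close> at the selected
  vector with label \<open>x\<close>, extended by zero to all other labels so that sums can run over
  full rectangles of labels.\<close>

definition relation_coeff ::
  "complex^'n^'n \<Rightarrow> complex^'m::{finite,linorder}^'n \<Rightarrow> ('n \<Rightarrow> nat \<times> 'm) \<Rightarrow> 'm \<Rightarrow> nat \<times> 'm \<Rightarrow> complex" where
  "relation_coeff A B \<beta> i x =
     (if x \<in> range \<beta>
      then (matrix_inv (selected_matrix A B \<beta>) *v krylov A B (kronecker_indices A B i, i)) $ inv \<beta> x else 0)"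

text \<open>These are the inputs of a Horner scheme for the relation, read from the highest power
  downwards: step \<open>q\<close> supplies the coefficients at power
  \<open>kronecker_indices A B i - q\<close>, and step 0 also supplies column \<open>i\<close>
  itself.\<close>

definition chain_coeff ::
  "complex^'n^'n \<Rightarrow> complex^'m::{finite,linorder}^'n \<Rightarrow> ('n \<Rightarrow> nat \<times> 'm) \<Rightarrow> 'm \<Rightarrow> nat \<Rightarrow> (complex, 'm) vec" where
  "chain_coeff A B \<beta> i q =
     (\<chi> j. (if q = 0 \<and> j = i then 1 else 0) - relation_coeff A B \<beta> i (kronecker_indices A B i - q, j))"

context
  fixes A :: "complex^'n^'n" and B :: "complex^'m::{finite,linorder}^'n" and \<beta> :: "'n \<Rightarrow> nat \<times> 'm"
  assumes reach: "reachable A B" and \<beta>: "bij_betw \<beta> UNIV (selected A B)"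
begin

lemma invertible_selected_matrix: "invertible (selected_matrix A B \<beta>)"
  unfolding selected_matrix_def by (rule invertible_column_matrixI[OF \<beta> span_selected[OF reach]])

text \<open>The preceding span is generated by basis vectors at positions before \<open>x\<close>,
  hence different from the one with label \<open>\<beta> p\<close>.\<close>

lemma coordinate_eq_0_of_preceding:
  assumes "y \<in> preceding_span A B x" "list_pos x \<le> list_pos (\<beta> p)"
  shows "(matrix_inv (selected_matrix A B \<beta>) *v y) $ p = 0"
  using assms(1) unfolding preceding_span_eq[OF reach]
proof (induction rule: vec.span_induct)
  case base
  then show ?case
    by (auto simp: vec.subspace_def matrix_vector_right_distrib vector_scalar_commute)
next
  case (step y)
  then obtain z where z: "z \<in> selected A B" "list_pos z < list_pos x" "y = krylov A B z" by auto
  then obtain p' where p': "z = \<beta> p'" using \<beta> by (auto simp: bij_betw_def)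
  then have "p' \<noteq> p" using z assms(2) by auto
  moreover have "y = column p' (selected_matrix A B \<beta>)"
    by (simp add: z p' selected_matrix_def)
  ultimately show ?case
    by (simp add: matrix_inv_mult_column invertible_selected_matrix axis_def)
qed

text \<open>The vector at \<open>(kronecker_indices A B i, i)\<close> is not selected, so it lies in
  its preceding span and has no coordinates at later positions.\<close>

lemma relation_coeff_nonzero:
  assumes "relation_coeff A B \<beta> i x \<noteq> 0"
  shows "list_pos x < list_pos (kronecker_indices A B i, i)"
proof (rule ccontr)
  assume "\<not> ?thesis"
  moreover have "krylov A B (kronecker_indices A B i, i) \<in> preceding_span A B (kronecker_indices A B i, i)"
    using selected_iff[OF reach, of "(kronecker_indices A B i, i)"] by (simp add: selected_def)
  ultimately show False
    using assms coordinate_eq_0_of_preceding[of _ "(kronecker_indices A B i, i)" "inv \<beta> x"]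
    by (auto simp: relation_coeff_def f_inv_into_f split: if_splits)
qed

lemma krylov_relation:
  "krylov A B (kronecker_indices A B i, i) =
     (\<Sum>k\<le>kronecker_indices A B i. \<Sum>j\<in>UNIV. relation_coeff A B \<beta> i (k, j) *s krylov A B (k, j))"
proof -
  let ?\<kappa> = "kronecker_indices A B i" and ?M = "selected_matrix A B \<beta>"
  let ?y = "krylov A B (?\<kappa>, i)" and ?h = "\<lambda>x. relation_coeff A B \<beta> i x *s krylov A B x"
  have inj: "inj \<beta>" using \<beta> by (simp add: bij_betw_def)
  have "?y = ?M *v (matrix_inv ?M *v ?y)"
    by (simp add: matrix_vector_mul_assoc matrix_inv_mult invertible_selected_matrix)
  also have "\<dots> = (\<Sum>p\<in>UNIV. (matrix_inv ?M *v ?y) $ p *s column p ?M)"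
    by (rule matrix_mult_sum)
  also have "\<dots> = (\<Sum>p\<in>UNIV. ?h (\<beta> p))"
    using inj by (simp add: relation_coeff_def selected_matrix_def)
  also have "\<dots> = (\<Sum>x\<in>range \<beta>. ?h x)"
    by (simp add: sum.reindex inj)
  \<comment> \<open>Labels outside the rectangle come too late in the list to carry a nonzero
    coefficient; labels outside the range of \<beta> carry zero by definition.\<close>
  also have "\<dots> = (\<Sum>x\<in>{..?\<kappa>} \<times> UNIV. ?h x)"
  proof (rule sum.mono_neutral_cong)
    show "?h x = 0" if x: "x \<in> range \<beta> - {..?\<kappa>} \<times> UNIV" for x
    proof -
      have "\<not> list_pos x < list_pos (?\<kappa>, i)"
        using x by (cases x) (auto simp: list_pos_less_iff)
      then have "relation_coeff A B \<beta> i x = 0" using relation_coeff_nonzero by blast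
      then show ?thesis by simp
    qed
  qed (auto simp: relation_coeff_def)
  also have "\<dots> = (\<Sum>k\<le>?\<kappa>. \<Sum>j\<in>UNIV. ?h (k, j))"
    by (simp add: sum.cartesian_product split_def)
  finally show ?thesis .
qed

lemma chain_eq_krylov_diff:
  "chain A B (chain_coeff A B \<beta> i) l = krylov A B (l, i) -
     (\<Sum>q\<le>l. \<Sum>j\<in>UNIV. relation_coeff A B \<beta> i (kronecker_indices A B i - q, j) *s krylov A B (l - q, j))"
proof -
  have "mpow A (l - q) *v (B *v chain_coeff A B \<beta> i q) = (if q = 0 then krylov A B (l, i) else 0) -
      (\<Sum>j\<in>UNIV. relation_coeff A B \<beta> i (kronecker_indices A B i - q, j) *s krylov A B (l - q, j))" for q
  proof -
    have "mpow A (l - q) *v (B *v chain_coeff A B \<beta> i q) =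
        (\<Sum>j\<in>UNIV. chain_coeff A B \<beta> i q $ j *s krylov A B (l - q, j))"
      by (simp add: matrix_mult_sum[of B] vec.linear_sum[OF matrix_vector_mul_linear_gen] vector_scalar_commute krylov_def)
    also have "\<dots> = (\<Sum>j\<in>UNIV. (if j = i then (if q = 0 then krylov A B (l - q, i) else 0) else 0)) -
       (\<Sum>j\<in>UNIV. relation_coeff A B \<beta> i (kronecker_indices A B i - q, j) *s krylov A B (l - q, j))"
      unfolding sum_subtractf[symmetric]
      by (intro sum.cong refl) (simp add: chain_coeff_def vec.scale_left_diff_distrib)
    finally show ?thesis by simp
  qed
  then show ?thesis
    by (simp add: chain_eq_sum sum_subtractf)
qed

text \<open>At the last step the subtracted sum, read in reverse order, is the whole relation for
  the first rejected vector.\<close>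

lemma chain_end: "chain A B (chain_coeff A B \<beta> i) (kronecker_indices A B i) = 0"
proof -
  let ?\<kappa> = "kronecker_indices A B i" and ?h = "\<lambda>k j. relation_coeff A B \<beta> i (k, j) *s krylov A B (k, j)"
  have "(\<Sum>q\<le>?\<kappa>. \<Sum>j\<in>UNIV. ?h (?\<kappa> - q) j) = (\<Sum>k\<le>?\<kappa>. \<Sum>j\<in>UNIV. ?h k j)"
    by (rule sum.reindex_bij_witness[of _ "\<lambda>q. ?\<kappa> - q" "\<lambda>q. ?\<kappa> - q"]) auto
  then show ?thesis
    by (simp add: chain_eq_krylov_diff krylov_relation[symmetric])
qed

text \<open>Lowering both powers by the same amount preserves the list order, so the terms of the
  relation still precede. The bounds \<open>q \<le> l\<close> and
  \<open>l \<le> kronecker_indices A B i\<close> keep the natural-number subtractions from being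
  truncated.\<close>

lemma chain_triangular:
  assumes "l \<le> kronecker_indices A B i"
  shows "chain A B (chain_coeff A B \<beta> i) l - krylov A B (l, i) \<in> preceding_span A B (l, i)"
proof -
  have "relation_coeff A B \<beta> i (kronecker_indices A B i - q, j) *s krylov A B (l - q, j) \<in> preceding_span A B (l, i)"
    if "q \<le> l" for q j
  proof (cases "relation_coeff A B \<beta> i (kronecker_indices A B i - q, j) = 0")
    case False
    then have "list_pos (l - q, j) < list_pos (l, i)"
      using relation_coeff_nonzero[OF False] that assms by (auto simp: list_pos_less_iff)
    then show ?thesis
      unfolding preceding_span_def by (intro vec.span_scale vec.span_base) auto
  qed (simp add: preceding_span_def vec.span_zero)
  then have "- (\<Sum>q\<le>l. \<Sum>j\<in>UNIV. relation_coeff A B \<beta> i (kronecker_indices A B i - q, j) *s krylov A B (l - q, j))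
      \<in> preceding_span A B (l, i)"
    unfolding preceding_span_def by (intro vec.span_neg vec.span_sum) auto
  then show ?thesis by (simp add: chain_eq_krylov_diff)
qed

lemma invertible_chain_matrix:
  "invertible (column_matrix (\<lambda>p. chain A B (chain_coeff A B \<beta> (snd (\<beta> p))) (fst (\<beta> p))))"
proof (rule invertible_column_matrixI[OF \<beta>])
  show "vec.span ((\<lambda>x. chain A B (chain_coeff A B \<beta> (snd x)) (fst x)) ` selected A B) = UNIV"
    by (rule span_triangular[OF reach]) (use chain_triangular in \<open>fastforce simp: selected_def\<close>)
qed

text \<open>In the top row of the relation only columns \<open>j < i\<close> can occur, because
  \<open>(kronecker_indices A B i, j)\<close> has to precede
  \<open>(kronecker_indices A B i, i)\<close>.\<close>

lemma unit_upper_triangular_chain_coeff: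
  "unit_upper_triangular (column_matrix (\<lambda>i. chain_coeff A B \<beta> i 0))"
proof -
  have "relation_coeff A B \<beta> i (kronecker_indices A B i, j) = 0" if "i \<le> j" for i j
    by (rule ccontr) (use relation_coeff_nonzero[of i "(kronecker_indices A B i, j)"] that in \<open>auto simp: list_pos_less_iff\<close>)
  then show ?thesis
    by (auto simp: unit_upper_triangular_def column_matrix_def chain_coeff_def)
qed

end

lemma matrix_mult_minus_right:
  fixes M :: "complex^'m^'n" and N :: "complex^'k^'m"
  shows "M ** (- N) = - (M ** N)"
  by (simp add: matrix_matrix_mult_def vec_eq_iff sum_negf)

section \<open>Feedback to uniformly reachable form\<close>

text \<open>\<open>A\<close> acts on the chain as a weighted cyclic shift; each full turn of
  \<kappa> steps contributes one factor \<open>g\<close>.\<close>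

lemma mpow_cyclic:
  fixes A :: "complex^'n^'n" and w :: "nat \<Rightarrow> complex^'n"
  assumes step: "\<And>l. Suc l < \<kappa> \<Longrightarrow> A *v w l = w (Suc l)" and last: "A *v w (\<kappa> - 1) = g *s w 0"
    and l: "l < \<kappa>"
  shows "mpow A (l + q * \<kappa>) *v w 0 = g ^ q *s w l"
proof -
  have pow: "mpow A k *v w 0 = w k" if "k < \<kappa>" for k
    using that by (induction k) (simp_all add: mpow_Suc_mult_vec step del: mpow.simps(2))
  have "\<kappa> = Suc (\<kappa> - 1)" using l by simp
  then have full: "mpow A \<kappa> *v w 0 = g *s w 0"
    using pow[of "\<kappa> - 1"] last mpow_Suc_mult_vec[of A "\<kappa> - 1" "w 0"] l by simp
  have "mpow A (q * \<kappa>) *v w 0 = g ^ q *s w 0"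
  proof (induction q)
    case (Suc q)
    have "mpow A (Suc q * \<kappa>) *v w 0 = mpow A (q * \<kappa>) *v (mpow A \<kappa> *v w 0)"
      by (simp add: mpow_add[symmetric] matrix_vector_mul_assoc add.commute)
    then show ?case by (simp add: full vector_scalar_commute Suc.IH)
  qed simp
  then show ?thesis
    by (simp add: mpow_add matrix_vector_mul_assoc[symmetric] vector_scalar_commute pow[OF l])
qed

text \<open>Constancy of the indices lets a single enumeration \<beta> and fixed powers serve all
  parameters, so that basis matrices and relation coefficients are continuous in
  \<open>t\<close>.\<close>

lemma ex_cyclic_feedback:
  fixes P :: "complex set" and A :: "complex \<Rightarrow> complex^'n^'n"
    and B :: "complex \<Rightarrow> complex^'m::{finite,linorder}^'n" and g :: "complex \<Rightarrow> complex"
  assumes ne: "P \<noteq> {}" and A: "continuous_on P A" and B: "continuous_on P B" and g: "continuous_on P g"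
    and reach: "\<And>t. t \<in> P \<Longrightarrow> reachable (A t) (B t)"
    and const: "\<And>t t'. t \<in> P \<Longrightarrow> t' \<in> P \<Longrightarrow> kronecker_indices (A t) (B t) = kronecker_indices (A t') (B t')"
  obtains T F S and W :: "complex \<Rightarrow> complex^'n^'n" where "restricted_feedback P T F S"
    "continuous_on P (fb_A T F S A B)" "continuous_on P (fb_B T F S A B)"
    "continuous_on P W" "\<And>t. t \<in> P \<Longrightarrow> invertible (W t)"
    "\<And>p q. \<exists>N i. \<forall>t\<in>P. mpow (fb_A T F S A B t) N *v column i (fb_B T F S A B t) = g t ^ q *s column p (W t)"
proof -
  obtain t0 where t0: "t0 \<in> P" using ne by auto
  define \<kappa> where "\<kappa> = kronecker_indices (A t0) (B t0)"
  define K where "K = selected (A t0) (B t0)"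
  have \<kappa>: "kronecker_indices (A t) (B t) = \<kappa>" if "t \<in> P" for t
    using const[OF that t0] by (simp add: \<kappa>_def)
  have K: "selected (A t) (B t) = K" if "t \<in> P" for t
    using \<kappa>[OF that] by (simp add: selected_def K_def \<kappa>_def)
  have "finite K" "card K = CARD('n)"
    unfolding K_def using finite_selected[OF reach[OF t0]] card_selected[OF reach[OF t0]] by auto
  then obtain \<beta> :: "'n \<Rightarrow> nat \<times> 'm" where \<beta>: "bij_betw \<beta> UNIV K"
    by (metis finite finite_same_card_bij)
  have \<beta>': "bij_betw \<beta> UNIV (selected (A t) (B t))" if "t \<in> P" for t
    using \<beta> K[OF that] by simp
  have lt: "fst (\<beta> p) < \<kappa> (snd (\<beta> p))" for p
    using bij_betwE[OF \<beta>] by (auto simp: K_def selected_def \<kappa>_def)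
  define c where "c = (\<lambda>t. chain_coeff (A t) (B t) \<beta>)"
  define w where "w = (\<lambda>t i. chain (A t) (B t) (c t i))"
  define W where "W = (\<lambda>t. column_matrix (\<lambda>p. w t (snd (\<beta> p)) (fst (\<beta> p))))"
  define U where "U = (\<lambda>t. column_matrix (\<lambda>i. c t i 0))"
  \<comment> \<open>Column \<open>p\<close> is the input that must be added at the basis vector
    \<open>p\<close>: the next input of its chain and, on the last vector, \<open>g t\<close> times
    the first input, which closes the cycle.\<close>
  define Y where "Y = (\<lambda>t. column_matrix (\<lambda>p. c t (snd (\<beta> p)) (Suc (fst (\<beta> p))) +
     (if Suc (fst (\<beta> p)) = \<kappa> (snd (\<beta> p)) then g t *s c t (snd (\<beta> p)) 0 else 0)))"
  \<comment> \<open>With this choice the new input matrix is \<open>B t ** U t\<close>, whose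
    columns are the initial vectors of the chains.\<close>
  define S where "S = (\<lambda>t. matrix_inv (U t))"
  \<comment> \<open>As \<open>U t ** S t\<close> is the identity, the feedback adds
    \<open>B t ** Y t ** matrix_inv (W t)\<close> to \<open>A t\<close>, and this sends column
    \<open>p\<close> of \<open>W t\<close> to \<open>B t\<close> applied to column \<open>p\<close>
    of \<open>Y t\<close>.\<close>
  define F where "F = (\<lambda>t. - (S t ** Y t ** matrix_inv (W t)))"
  define T :: "complex \<Rightarrow> complex^'n^'n" where "T = (\<lambda>t. mat 1)"

  have invM: "invertible (selected_matrix (A t) (B t) \<beta>)" if "t \<in> P" for t
    by (rule invertible_selected_matrix[OF reach[OF that] \<beta>'[OF that]])
  have cont_krylov: "continuous_on P (\<lambda>t. krylov (A t) (B t) x)" for x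
    unfolding krylov_def by (intro continuous_on_matrix_vector_mult continuous_on_mpow continuous_on_column A B)
  have "continuous_on P (\<lambda>t. matrix_inv (selected_matrix (A t) (B t) \<beta>) *v krylov (A t) (B t) (\<kappa> i, i))" for i
    unfolding selected_matrix_def
    by (intro continuous_on_matrix_vector_mult continuous_on_matrix_inv continuous_on_column_matrix cont_krylov)
      (use invM in \<open>simp add: selected_matrix_def\<close>)
  then have "continuous_on P (\<lambda>t. if x \<in> range \<beta> then
      (matrix_inv (selected_matrix (A t) (B t) \<beta>) *v krylov (A t) (B t) (\<kappa> i, i)) $ inv \<beta> x else 0)" for i x
    by (cases "x \<in> range \<beta>") (auto intro!: continuous_intros)
  note cont_if = this
  have cont_rc: "continuous_on P (\<lambda>t. relation_coeff (A t) (B t) \<beta> i x)" for i x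
    using cont_if[of x i] by (rule continuous_on_eq) (simp add: relation_coeff_def \<kappa>)
  have cont_c: "continuous_on P (\<lambda>t. c t i q)" for i q
  proof -
    have "continuous_on P (\<lambda>t. \<chi> j. (if q = 0 \<and> j = i then 1 else 0) - relation_coeff (A t) (B t) \<beta> i (\<kappa> i - q, j))"
      by (intro continuous_intros cont_rc)
    then show ?thesis
      by (rule continuous_on_eq) (simp add: c_def chain_coeff_def \<kappa>)
  qed
  have cont_w: "continuous_on P (\<lambda>t. w t i l)" for i l
    unfolding w_def by (intro continuous_on_chain A B cont_c)
  have cont_W: "continuous_on P W"
    unfolding W_def by (intro continuous_on_column_matrix cont_w)
  have invW: "invertible (W t)" if "t \<in> P" for t
    unfolding W_def w_def c_def by (rule invertible_chain_matrix[OF reach[OF that] \<beta>'[OF that]])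
  have cont_U: "continuous_on P U"
    unfolding U_def by (intro continuous_on_column_matrix cont_c)
  have triU: "unit_upper_triangular (U t)" if "t \<in> P" for t
    unfolding U_def c_def by (rule unit_upper_triangular_chain_coeff[OF reach[OF that] \<beta>'[OF that]])
  have invU: "invertible (U t)" if "t \<in> P" for t
    by (rule unit_upper_triangular_invertible[OF triU[OF that]])
  have cont_S: "continuous_on P S"
    unfolding S_def by (intro continuous_on_matrix_inv cont_U invU)
  have "continuous_on P (\<lambda>t. c t (snd (\<beta> p)) (Suc (fst (\<beta> p))) +
     (if Suc (fst (\<beta> p)) = \<kappa> (snd (\<beta> p)) then g t *s c t (snd (\<beta> p)) 0 else 0))" for p
    by (cases "Suc (fst (\<beta> p)) = \<kappa> (snd (\<beta> p))") (auto intro!: continuous_intros continuous_on_smult cont_c g)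
  then have cont_Y: "continuous_on P Y"
    unfolding Y_def by (intro continuous_on_column_matrix)
  have cont_F: "continuous_on P F"
    unfolding F_def by (intro continuous_on_minus continuous_on_matrix_mult continuous_on_matrix_inv cont_S cont_Y cont_W invW)
  have rf: "restricted_feedback P T F S"
    unfolding restricted_feedback_def
    using cont_F cont_S triU
    by (auto simp: S_def T_def intro: unit_upper_triangular_matrix_inv continuous_intros
        simp: invertible_def intro!: exI[of _ "mat 1"])

  have Sinv: "matrix_inv (S t) = U t" if "t \<in> P" for t
    unfolding S_def by (rule matrix_inv_eqI) (rule matrix_inv_mult(2)[OF invU[OF that]])
  have Tinv: "matrix_inv (mat 1 :: complex^'n^'n) = mat 1" by (rule matrix_inv_eqI) simp
  have fbB: "fb_B T F S A B t = B t ** U t" if "t \<in> P" for t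
    by (simp add: fb_B_def T_def Sinv[OF that])
  have fbA: "fb_A T F S A B t = A t + B t ** Y t ** matrix_inv (W t)" if "t \<in> P" for t
  proof -
    have "B t ** U t ** F t = - (B t ** (U t ** S t) ** Y t ** matrix_inv (W t))"
      by (simp add: F_def matrix_mul_assoc matrix_mult_minus_right)
    also have "U t ** S t = mat 1" unfolding S_def by (rule matrix_inv_mult(1)[OF invU[OF that]])
    finally show ?thesis by (simp add: fb_A_def T_def Sinv[OF that] Tinv)
  qed
  have cont_fbB: "continuous_on P (fb_B T F S A B)"
    by (rule continuous_on_eq[OF continuous_on_matrix_mult[OF B cont_U]]) (simp add: fbB)
  have "continuous_on P (\<lambda>t. A t + B t ** Y t ** matrix_inv (W t))"
    by (intro continuous_on_add continuous_on_matrix_mult continuous_on_matrix_inv A B cont_Y cont_W invW)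
  then have cont_fbA: "continuous_on P (fb_A T F S A B)"
    by (rule continuous_on_eq) (simp add: fbA)

  have act: "fb_A T F S A B t *v w t (snd (\<beta> p)) (fst (\<beta> p)) = w t (snd (\<beta> p)) (Suc (fst (\<beta> p))) +
      (if Suc (fst (\<beta> p)) = \<kappa> (snd (\<beta> p)) then g t *s w t (snd (\<beta> p)) 0 else 0)" if t: "t \<in> P" for t p
  proof -
    let ?i = "snd (\<beta> p)" and ?l = "fst (\<beta> p)"
    have Wp: "w t ?i ?l = column p (W t)" by (simp add: W_def)
    have "(B t ** Y t ** matrix_inv (W t)) *v w t ?i ?l = B t *v column p (Y t)"
      unfolding Wp by (simp add: matrix_vector_mul_assoc[symmetric] matrix_inv_mult_column invW[OF t])
        (simp add: matrix_vector_mul_assoc matrix_vector_mult_axis[symmetric])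
    also have "\<dots> = B t *v c t ?i (Suc ?l) + (if Suc ?l = \<kappa> ?i then g t *s (B t *v c t ?i 0) else 0)"
      by (simp add: Y_def matrix_vector_right_distrib vector_scalar_commute)
    finally show ?thesis
      by (simp add: fbA[OF t] matrix_vector_mult_add_rdistrib w_def)
  qed
  have cyc: "\<exists>N i. \<forall>t\<in>P. mpow (fb_A T F S A B t) N *v column i (fb_B T F S A B t) = g t ^ q *s column p (W t)" for p q
  proof (intro exI ballI)
    fix t assume t: "t \<in> P"
    let ?i = "snd (\<beta> p)" and ?l = "fst (\<beta> p)"
    \<comment> \<open>Every label on the chain of \<open>?i\<close> is enumerated by \<beta>, so the
      action is known at all its vectors and not only at the one with index
      \<open>p\<close>.\<close>
    have act': "fb_A T F S A B t *v w t ?i l = w t ?i (Suc l) + (if Suc l = \<kappa> ?i then g t *s w t ?i 0 else 0)"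
      if l: "l < \<kappa> ?i" for l
    proof -
      have "(l, ?i) \<in> K" using l by (simp add: K_def selected_def \<kappa>_def)
      then obtain p' where "\<beta> p' = (l, ?i)" using \<beta> unfolding bij_betw_def by (metis imageE)
      then show ?thesis using act[OF t, of p'] by simp
    qed
    have w_end: "w t ?i (\<kappa> ?i) = 0"
      using chain_end[OF reach[OF t] \<beta>'[OF t], of ?i] by (simp add: w_def c_def \<kappa>[OF t])
    have "column ?i (fb_B T F S A B t) = B t *v column ?i (U t)"
      by (simp only: fbB[OF t] matrix_vector_mult_axis[symmetric] matrix_vector_mul_assoc)
    then have w0: "column ?i (fb_B T F S A B t) = w t ?i 0"
      by (simp add: U_def w_def)
    \<comment> \<open>This fixes the witnesses: the exponent \<open>?l + q * \<kappa> ?i\<close> and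
      the column \<open>?i\<close>, neither of which depends on \<open>t\<close>.\<close>
    have "mpow (fb_A T F S A B t) (?l + q * \<kappa> ?i) *v w t ?i 0 = g t ^ q *s w t ?i ?l"
    proof (rule mpow_cyclic[OF _ _ lt])
      show "fb_A T F S A B t *v w t ?i (\<kappa> ?i - 1) = g t *s w t ?i 0"
        using act'[of "\<kappa> ?i - 1"] lt[of p] w_end by simp
    qed (use act' in auto)
    then show "mpow (fb_A T F S A B t) (?l + q * \<kappa> ?i) *v column ?i (fb_B T F S A B t) = g t ^ q *s column p (W t)"
      by (simp add: w0 W_def)
  qed
  show ?thesis
    by (rule that[OF rf cont_fbA cont_fbB cont_W invW cyc])
qed

theorem mainTheorem3:
  fixes P :: "complex set"
    and A :: "complex \<Rightarrow> complex^'n^'n"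
    and B :: "complex \<Rightarrow> complex^'m::{finite,linorder}^'n"
  assumes "jordan_arc P"
    and "continuous_on P A" and "continuous_on P B"
    and "\<forall>\<theta>\<in>P. reachable (A \<theta>) (B \<theta>)"
    and "\<forall>\<theta>\<in>P. \<forall>\<theta>'\<in>P. kronecker_indices (A \<theta>) (B \<theta>) = kronecker_indices (A \<theta>') (B \<theta>')"
  shows "(\<exists>T F S. restricted_feedback P T F S \<and>
            uer_ct P (fb_A T F S A B) (fb_B T F S A B))
       \<and> (\<exists>T F S. restricted_feedback P T F S \<and>
            uer_dt P (fb_A T F S A B) (fb_B T F S A B))"
proof -
  obtain \<gamma> :: "real \<Rightarrow> complex" and g where gamma: "continuous_on {0..1} \<gamma>" "continuous_on P g"
    "\<And>t. t \<in> P \<Longrightarrow> g t \<in> {0..1} \<and> \<gamma> (g t) = t" "\<gamma> ` {0..1} = P"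
    using arc_inverse[OF assms(1)] by blast
  have ne: "P \<noteq> {}" using gamma(4) by auto
  have P: "compact P" using gamma(1,4) by (metis compact_Icc compact_continuous_image)
  have g: "continuous_on P (\<lambda>t. complex_of_real (g t))" by (intro continuous_intros gamma)
  obtain T F S and W :: "complex \<Rightarrow> complex^'n^'n" where rf: "restricted_feedback P T F S"
    and cont: "continuous_on P (fb_A T F S A B)" "continuous_on P (fb_B T F S A B)"
    and W: "continuous_on P W" "\<And>t. t \<in> P \<Longrightarrow> invertible (W t)"
    and cyc: "\<And>p q. \<exists>N i. \<forall>t\<in>P. mpow (fb_A T F S A B t) N *v column i (fb_B T F S A B t)
        = complex_of_real (g t) ^ q *s column p (W t)"
    by (rule ex_cyclic_feedback[OF ne assms(2,3) g]) (use assms(4,5) in blast)+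
  \<comment> \<open>Both time notions are reduced to one claim: a uniformly closed subspace that
    contains the Krylov functions of the new pair contains every continuous function. The same
    feedback then serves both conjuncts.\<close>
  have dense: "f \<in> V" if V: "unif_closed_subspace P V" and f: "continuous_on P f"
    and mem: "\<And>N i. (\<lambda>t. mpow (fb_A T F S A B t) N *v column i (fb_B T F S A B t)) \<in> V"
    for V and f :: "complex \<Rightarrow> complex^'n"
  proof -
    have mem': "(\<lambda>t. complex_of_real (g t) ^ q *s column p (W t)) \<in> V" for p q
    proof -
    obtain N i where "\<forall>t\<in>P. mpow (fb_A T F S A B t) N *v column i (fb_B T F S A B t)
        = complex_of_real (g t) ^ q *s column p (W t)"
      using cyc by blast
    then show ?thesis
      by (intro ucs_cong[OF V mem[of N i]]) auto
    qed
    show ?thesis by (rule all_continuous_mem[OF V gamma(1,4,3) W mem' f])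
  qed
  have "uer_ct P (fb_A T F S A B) (fb_B T F S A B)"
    by (rule uer_ctI[OF ne])
      (rule dense[OF unif_closed_subspace_reach_ct _ mpow_column_mem_reach_ct[OF P cont]])
  moreover have "uer_dt P (fb_A T F S A B) (fb_B T F S A B)"
    by (rule uer_dtI[OF ne])
      (rule dense[OF unif_closed_subspace_reach_dt _ unif_closure_incl[OF mpow_column_mem_reach_dt]])
  ultimately show ?thesis using rf by blast
qed

end
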